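(* Let $\mathcal{C}$ be a deterministic time-complexity class with $\mathcal{C}\subseteq \mathrm{SubExp}$. Let $G$ be a finitely presented group whose word problem is in $\mathrm{SubExp}$. Suppose $G$ has a subgroup of finite index which possesses a non-amenable quotient group $\bar G_1$ whose word problem is solvable in the complexity class $\mathcal{C}$. Then for any finite generating set $A$ of $G$, the word problem $WP(G,A)\subseteq (A\cup A^{-1})^*$ is solvable with average-case time-complexity in $\mathcal{C}$ uniformly relative to the family of all length-invariant discrete probability measures $\mu:(A\cup A^{-1})^*\to[0,1]$.
   Context: Word problem: a finite generating set of a group $G$ is a finite alphabet $A$ with a map $\pi: A\to G$ whose image generates $G$ (different letters may represent the same element, and letters may represent $1$). Put $X=A\cup A^{-1}$, where $A^{-1}$ is the set of formal inverses, and let $X^*$ be the set of all (not necessarily freely reduced) words in $X$. Then $WP(G,A)\subseteq X^*$ is the set of words representing $1\in G$. Its worst-case complexity does not depend on the choice of finite generating set, so one speaks of the word problem of $G$. Complexity: an algorithm is a deterministic multi-tape Turing machine. Only deterministic time-complexity classes are considered. It is assumed that the collection of functions bounding the computation time in a class $\mathcal{C}$ consists of proper complexity functions $f(n)\ge n$, and that for each $f$ in the collection and each integer $C\ge 1$ the function $Cf(Cn+C)+C$ is also in the collection. A non-negative function $f(n)$ is subexponential if $\lim_{n\to\infty} f(n)/r^n=0$ for every $r>1$. $\mathrm{SubExp}$ is the class of languages decidable in deterministic subexponential time. Measures: for a finite alphabet $X$ with $|X|\ge 2$, a discrete probability measure on $X^*$ is a function $\mu:X^*\to[0,1]$ with $\sum_{w\in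 X^*}\mu(w)=1$; it is length-invariant if $\mu(w)=\mu(w')$ whenever $|w|=|w'|$. Average-case complexity: let $\mathcal{D}\subseteq X^*$ and let $M$ be an algorithm that decides, for every $w\in X^*$, whether $w\in\mathcal{D}$, in time $T(w)<\infty$. Let $f(n)$ be a non-decreasing positive function and let $\mathfrak{R}$ be a family of discrete probability measures on $X^*$. $M$ solves $\mathcal{D}$ with average-case time-complexity bounded by $f(n)$ uniformly relative to $\mathfrak{R}$ if there is $0<C<\infty$ such that for every $\mu\in\mathfrak{R}$, $$\sum_{w\in X^*}\frac{T(w)}{f(|w|)}\mu(w)\le C.$$ If such an $f$ satisfies the bound constraint of a time-complexity class $\mathcal{C}$, then $M$ solves $\mathcal{D}$ with average-case time-complexity in $\mathcal{C}$ uniformly relative to $\mathfrak{R}$. $\mathcal{D}$ is solvable with this average-case complexity if some such $M$ exists. *)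

theory Defs
  imports
    "HOL-Analysis.Infinite_Sum"
    "HOL-Library.Landau_Symbols"
    "HOL-Algebra.Coset"
    "HOL-Algebra.Generated_Groups"
begin

text \<open>
  The conventions are those of Papadimitriou's textbook: tapes are one-way infinite, cell 0 of
  every tape carries the marker \<open>Start\<close>, which is never erased and always sends the head to the
  right, and the input is written on tape 0 in the cells 1, 2, \<dots>, with all heads initially on
  cell 0. The letters of an arbitrary input alphabet are embedded by \<open>Inp\<close>; the symbols
  \<open>Work i\<close> supply as many further tape symbols as a machine needs.
\<close>

datatype 'a tape_sym = Start | Blank | Inp 'a | Work nat

datatype head_move = MoveL | Stay | MoveR

datatype tm_state = Run nat | Yes | No | Halt

record 'a tm =
  num_tapes :: nat
  states :: "nat set"
  tape_alphabet :: "'a tape_sym set"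
  start_state :: nat
  transition :: "nat \<Rightarrow> 'a tape_sym list \<Rightarrow> tm_state \<times> ('a tape_sym \<times> head_move) list"

definition tm_reads :: "'a tm \<Rightarrow> 'a tape_sym list set" where
  "tm_reads M = {rs. length rs = num_tapes M \<and> set rs \<subseteq> tape_alphabet M}"

definition wf_tm :: "'a set \<Rightarrow> 'a tm \<Rightarrow> bool" where
  "wf_tm X M \<longleftrightarrow>
     num_tapes M \<ge> 1 \<and> finite (states M) \<and> start_state M \<in> states M \<and>
     finite (tape_alphabet M) \<and> {Start, Blank} \<union> Inp ` X \<subseteq> tape_alphabet M \<and>
     (\<forall>q\<in>states M. \<forall>rs\<in>tm_reads M.
        fst (transition M q rs) \<in> Run ` states M \<union> {Yes, No, Halt} \<and>
        length (snd (transition M q rs)) = num_tapes M \<and>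
        fst ` set (snd (transition M q rs)) \<subseteq> tape_alphabet M \<and>
        (\<forall>i<num_tapes M. rs ! i = Start \<longrightarrow> snd (transition M q rs) ! i = (Start, MoveR)))"

type_synonym 'a tape = "(nat \<Rightarrow> 'a tape_sym) \<times> nat"

type_synonym 'a tm_config = "tm_state \<times> 'a tape list"

definition init_cells :: "'a list \<Rightarrow> nat \<Rightarrow> 'a tape_sym" where
  "init_cells w p =
     (if p = 0 then Start else if p \<le> length w then Inp (w ! (p - 1)) else Blank)"

definition init_config :: "'a tm \<Rightarrow> 'a list \<Rightarrow> 'a tm_config" where
  "init_config M w =
     (Run (start_state M), (init_cells w, 0) # replicate (num_tapes M - 1) (init_cells [], 0))"

fun move_head :: "head_move \<Rightarrow> nat \<Rightarrow> nat" where
  "move_head MoveL p = p - 1"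
| "move_head Stay p = p"
| "move_head MoveR p = Suc p"

fun act_on_tape :: "'a tape_sym \<times> head_move \<Rightarrow> 'a tape \<Rightarrow> 'a tape" where
  "act_on_tape (s, d) (c, p) = (c(p := s), move_head d p)"

fun tm_step :: "'a tm \<Rightarrow> 'a tm_config \<Rightarrow> 'a tm_config" where
  "tm_step M (Run q, ts) =
     (let r = transition M q (map (\<lambda>(c, p). c p) ts) in (fst r, map2 act_on_tape (snd r) ts))"
| "tm_step M (Yes, ts) = (Yes, ts)"
| "tm_step M (No, ts) = (No, ts)"
| "tm_step M (Halt, ts) = (Halt, ts)"

definition tm_run :: "'a tm \<Rightarrow> 'a list \<Rightarrow> nat \<Rightarrow> 'a tm_config" where
  "tm_run M w n = (tm_step M ^^ n) (init_config M w)"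

text \<open>The number of steps until \<open>M\<close> halts on \<open>w\<close>; meaningful only if \<open>M\<close> does halt on \<open>w\<close>.\<close>

definition tm_time :: "'a tm \<Rightarrow> 'a list \<Rightarrow> nat" where
  "tm_time M w = (LEAST n. fst (tm_run M w n) \<in> {Yes, No, Halt})"

definition tm_decides :: "'a tm \<Rightarrow> 'a set \<Rightarrow> 'a list set \<Rightarrow> bool" where
  "tm_decides M X L \<longleftrightarrow> wf_tm X M \<and>
     (\<forall>w\<in>lists X. \<exists>n. fst (tm_run M w n) = (if w \<in> L then Yes else No))"

text \<open>
  Proper complexity functions in the sense of Papadimitriou. A machine with input and output has a
  read-only first tape, whose head does not leave the input, and a last tape on which the head
  never moves left.
\<close>

definition input_output_tm :: "'a tm \<Rightarrow> bool" where
  "input_output_tm M \<longleftrightarrow> num_tapes M \<ge> 2 \<and>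
     (\<forall>q\<in>states M. \<forall>rs\<in>tm_reads M.
        fst (snd (transition M q rs) ! 0) = rs ! 0 \<and>
        (rs ! 0 = Blank \<longrightarrow> snd (snd (transition M q rs) ! 0) = MoveL) \<and>
        snd (snd (transition M q rs) ! (num_tapes M - 1)) \<noteq> MoveL)"

text \<open>
  The number of cells, apart from cell 0, that the head of tape \<open>i\<close> visits before \<open>M\<close> halts.
\<close>

definition tape_space :: "'a tm \<Rightarrow> 'a list \<Rightarrow> nat \<Rightarrow> nat" where
  "tape_space M w i = Max ((\<lambda>n. snd (snd (tm_run M w n) ! i)) ` {..tm_time M w})"

text \<open>
  On every input of length \<open>n\<close> the machine writes \<open>f n\<close> copies of the symbol \<open>Work 0\<close> (Papadimitriou's
  quasi-blank) on the last tape and leaves its working tapes blank, the running time \<open>t n\<close> and the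
  space \<open>j i n\<close> used on each working tape depending on \<open>n\<close> only.
\<close>

definition proper_complexity_function :: "(nat \<Rightarrow> nat) \<Rightarrow> bool" where
  "proper_complexity_function f \<longleftrightarrow> mono f \<and>
     (\<exists>(X :: nat set) M t j.
        finite X \<and> X \<noteq> {} \<and> wf_tm X M \<and> input_output_tm M \<and>
        (\<lambda>n. real (t n)) \<in> O(\<lambda>n. real (n + f n)) \<and>
        (\<forall>i\<in>{1..<num_tapes M - 1}. (\<lambda>n. real (j i n)) \<in> O(\<lambda>n. real (f n))) \<and>
        (\<forall>x\<in>lists X.
           fst (tm_run M x (t (length x))) = Halt \<and>
           tm_time M x = t (length x) \<and>
           (\<forall>i\<in>{1..<num_tapes M - 1}.
              fst (snd (tm_run M x (t (length x))) ! i) = init_cells [] \<and>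
              tape_space M x i = j i (length x)) \<and>
           fst (snd (tm_run M x (t (length x))) ! (num_tapes M - 1)) =
             (\<lambda>p. if p = 0 then Start else if p \<le> f (length x) then Work 0 else Blank)))"

definition time_bounds :: "(nat \<Rightarrow> nat) set \<Rightarrow> bool" where
  "time_bounds F \<longleftrightarrow>
     (\<forall>f\<in>F. proper_complexity_function f \<and> (\<forall>n. n \<le> f n)) \<and>
     (\<forall>f\<in>F. \<forall>C\<ge>1. (\<lambda>n. C * f (C * n + C) + C) \<in> F)"

text \<open>A language is given together with its alphabet, as a pair \<open>(X, L)\<close>.\<close>

type_synonym 'a language = "'a set \<times> 'a list set"

definition DTIME :: "(nat \<Rightarrow> real) \<Rightarrow> 'a language set" where
  "DTIME f = {(X, L). finite X \<and> L \<subseteq> lists X \<and>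
     (\<exists>M. tm_decides M X L \<and> (\<forall>w\<in>lists X. real (tm_time M w) \<le> f (length w)))}"

definition time_class :: "(nat \<Rightarrow> nat) set \<Rightarrow> 'a language set" where
  "time_class F = (\<Union>f\<in>F. DTIME (\<lambda>n. real (f n)))"

definition subexponential :: "(nat \<Rightarrow> real) \<Rightarrow> bool" where
  "subexponential f \<longleftrightarrow> (\<forall>n. 0 \<le> f n) \<and> (\<forall>r>1. (\<lambda>n. f n / r ^ n) \<longlonglongrightarrow> 0)"

definition SubExp :: "'a language set" where
  "SubExp = (\<Union>f\<in>{f. subexponential f}. DTIME f)"

definition discrete_prob_measure :: "'a set \<Rightarrow> ('a list \<Rightarrow> real) \<Rightarrow> bool" where
  "discrete_prob_measure X \<mu> \<longleftrightarrow> (\<forall>w\<in>lists X. \<mu> w \<in> {0..1}) \<and> (\<mu> has_sum 1) (lists X)"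

definition length_invariant_measures :: "'a set \<Rightarrow> ('a list \<Rightarrow> real) set" where
  "length_invariant_measures X = {\<mu>. discrete_prob_measure X \<mu> \<and>
     (\<forall>w\<in>lists X. \<forall>w'\<in>lists X. length w = length w' \<longrightarrow> \<mu> w = \<mu> w')}"

text \<open>
  The explicit summability condition is needed because \<open>infsum\<close> is 0 on divergent families.
\<close>

definition average_time_bounded ::
  "'a tm \<Rightarrow> 'a set \<Rightarrow> 'a list set \<Rightarrow> (nat \<Rightarrow> real) \<Rightarrow> ('a list \<Rightarrow> real) set \<Rightarrow> bool" where
  "average_time_bounded M X L f \<RR> \<longleftrightarrow>
     tm_decides M X L \<and> mono f \<and> (\<forall>n. 0 < f n) \<and>
     (\<exists>C>0. \<forall>\<mu>\<in>\<RR>.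
        (\<lambda>w. real (tm_time M w) / f (length w) * \<mu> w) summable_on lists X \<and>
        (\<Sum>\<^sub>\<infinity>w\<in>lists X. real (tm_time M w) / f (length w) * \<mu> w) \<le> C)"

definition average_case_solvable ::
  "'a set \<Rightarrow> 'a list set \<Rightarrow> (nat \<Rightarrow> nat) set \<Rightarrow> ('a list \<Rightarrow> real) set \<Rightarrow> bool" where
  "average_case_solvable X L F \<RR> \<longleftrightarrow>
     (\<exists>M. \<exists>f\<in>F. average_time_bounded M X L (\<lambda>n. real (f n)) \<RR>)"

text \<open>Letters of \<open>A \<union> A\<^sup>-\<^sup>1\<close>, where \<open>Neg a\<close> is the formal inverse of \<open>Pos a\<close>.\<close>

datatype 'x letter = Pos 'x | Neg 'x

definition letters :: "'x set \<Rightarrow> 'x letter set" where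
  "letters A = Pos ` A \<union> Neg ` A"

fun inv_letter :: "'x letter \<Rightarrow> 'x letter" where
  "inv_letter (Pos a) = Neg a"
| "inv_letter (Neg a) = Pos a"

fun letter_value :: "('g, 'b) monoid_scheme \<Rightarrow> ('x \<Rightarrow> 'g) \<Rightarrow> 'x letter \<Rightarrow> 'g" where
  "letter_value G \<pi> (Pos a) = \<pi> a"
| "letter_value G \<pi> (Neg a) = inv\<^bsub>G\<^esub> (\<pi> a)"

fun word_value :: "('g, 'b) monoid_scheme \<Rightarrow> ('x \<Rightarrow> 'g) \<Rightarrow> 'x letter list \<Rightarrow> 'g" where
  "word_value G \<pi> [] = \<one>\<^bsub>G\<^esub>"
| "word_value G \<pi> (l # w) = letter_value G \<pi> l \<otimes>\<^bsub>G\<^esub> word_value G \<pi> w"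

definition finite_generating_set :: "('g, 'b) monoid_scheme \<Rightarrow> 'x set \<Rightarrow> ('x \<Rightarrow> 'g) \<Rightarrow> bool" where
  "finite_generating_set G A \<pi> \<longleftrightarrow>
     finite A \<and> \<pi> ` A \<subseteq> carrier G \<and> generate G (\<pi> ` A) = carrier G"

definition WP :: "('g, 'b) monoid_scheme \<Rightarrow> 'x set \<Rightarrow> ('x \<Rightarrow> 'g) \<Rightarrow> 'x letter list set" where
  "WP G A \<pi> = {w \<in> lists (letters A). word_value G \<pi> w = \<one>\<^bsub>G\<^esub>}"

text \<open>
  The choice of the finite generating set does not matter, and an alphabet consisting of natural
  numbers is no restriction.
\<close>

definition word_problem_in :: "('g, 'b) monoid_scheme \<Rightarrow> nat letter language set \<Rightarrow> bool" where
  "word_problem_in G \<C> \<longleftrightarrow>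
     (\<exists>A \<pi>. finite_generating_set G A \<pi> \<and> (letters A, WP G A \<pi>) \<in> \<C>)"

text \<open>
  The group \<open>\<langle>A | R\<rangle>\<close>: words modulo insertion and deletion of relators and of pairs of mutually
  inverse letters.
\<close>

inductive_set presentation_eq :: "'x set \<Rightarrow> 'x letter list set \<Rightarrow> ('x letter list \<times> 'x letter list) set"
  for A :: "'x set" and R :: "'x letter list set" where
  refl: "u \<in> lists (letters A) \<Longrightarrow> (u, u) \<in> presentation_eq A R"
| sym: "(u, v) \<in> presentation_eq A R \<Longrightarrow> (v, u) \<in> presentation_eq A R"
| trans: "(u, v) \<in> presentation_eq A R \<Longrightarrow> (v, w) \<in> presentation_eq A R \<Longrightarrow>
    (u, w) \<in> presentation_eq A R"
| cancel: "u \<in> lists (letters A) \<Longrightarrow> v \<in> lists (letters A) \<Longrightarrow> l \<in> letters A \<Longrightarrow>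
    (u @ [l, inv_letter l] @ v, u @ v) \<in> presentation_eq A R"
| relator: "u \<in> lists (letters A) \<Longrightarrow> v \<in> lists (letters A) \<Longrightarrow> r \<in> R \<Longrightarrow>
    (u @ r @ v, u @ v) \<in> presentation_eq A R"

definition presented_group :: "'x set \<Rightarrow> 'x letter list set \<Rightarrow> 'x letter list set monoid" where
  "presented_group A R =
     \<lparr>carrier = lists (letters A) // presentation_eq A R,
      mult = (\<lambda>U V. presentation_eq A R `` {u @ v |u v. u \<in> U \<and> v \<in> V}),
      one = presentation_eq A R `` {[]}\<rparr>"

definition finitely_presented :: "('g, 'b) monoid_scheme \<Rightarrow> bool" where
  "finitely_presented G \<longleftrightarrow>
     (\<exists>(A :: nat set) R. finite A \<and> finite R \<and> R \<subseteq> lists (letters A) \<and> G \<cong> presented_group A R)"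

text \<open>Amenability of a discrete group, in von Neumann's sense.\<close>

definition amenable :: "('g, 'b) monoid_scheme \<Rightarrow> bool" where
  "amenable G \<longleftrightarrow>
     (\<exists>m :: 'g set \<Rightarrow> real.
        m (carrier G) = 1 \<and>
        (\<forall>S \<subseteq> carrier G. 0 \<le> m S) \<and>
        (\<forall>S \<subseteq> carrier G. \<forall>T \<subseteq> carrier G. S \<inter> T = {} \<longrightarrow> m (S \<union> T) = m S + m T) \<and>
        (\<forall>g \<in> carrier G. \<forall>S \<subseteq> carrier G. m (g <#\<^bsub>G\<^esub> S) = m S))"

end

theory Submission
  imports Defs "HOL-Library.Countable" "HOL-Analysis.Function_Topology" "HOL-Analysis.L2_Norm"
begin

text \<open>
  Given a word, first compute its coset of \<open>H\<close> and, by Reidemeister--Schreier rewriting, its image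
  in \<open>H/N\<close>, and solve the word problem there within the given class; only if the word passes this
  test is the subexponential algorithm for \<open>G\<close> run. The words that pass are the closed paths
  in the Schreier graph of \<open>N\<close>, that is, of the action of \<open>G\<close> on \<open>G/N\<close>. Almost
  invariant vectors for this action would produce an invariant mean on \<open>G/N\<close>, which restricts to
  one on \<open>H/N\<close> because finitely many translates of \<open>H/N\<close> cover \<open>G/N\<close>. So for
  non-amenable \<open>H/N\<close> there is a spectral gap, an exponentially small proportion of all words of a
  given length passes the test, and this outweighs the cost of the subexponential algorithm.
\<close>

section \<open>Turing machines\<close>

text \<open>The average is won by a balance of exponents. Rewriting lengthens a word at most by a
  factor \<open>B\<close>, so for every \<open>r > 1\<close> the subexponential algorithm costs at
  most \<open>k * r ^ (B * n)\<close> on inputs of length \<open>n\<close>; the choice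
  \<open>r ^ B = 1 / \<rho>\<close> makes this cancel the proportion \<open>\<rho> ^ n\<close> of
  words on which it is run. Length-invariance enters by making every measure constant on the words
  of a given length, so that only totals per length matter. What remains is the cost of rewriting
  and testing, and the closure of the class under \<open>C * f (C * n + C) + C\<close> absorbs it.
  Two obstacles shape the development. \<open>N\<close> is normal in \<open>H\<close> only, so the
  spectral argument is made for a set with invertible moves instead of a group; it uses finitely
  supported functions and finite sums throughout. And the combined algorithm has to exist as one
  Turing machine: its transducer also translates the letters of \<open>A\<close> into the generating
  sets for which the two given machines work, so independence of the generating set is obtained
  along the way.\<close>

instance letter :: (countable) countable by countable_datatype

definition read :: "'a tape \<Rightarrow> 'a tape_sym" where
  "read t = fst t (snd t)"

text \<open>
  The head of an unused tape stays, except that \<open>wf_tm\<close> forces it to the right on \<open>Start\<close>.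
\<close>

definition idle :: "'a tape_sym \<Rightarrow> 'a tape_sym \<times> head_move" where
  "idle s = (s, if s = Start then MoveR else Stay)"

definition settle :: "'a tape \<Rightarrow> 'a tape" where
  "settle t = act_on_tape (idle (read t)) t"

text \<open>Imposes the rule of \<open>wf_tm\<close> for \<open>Start\<close> from outside, so that
  a transition table may be written down without regard to it.\<close>

definition guard :: "'a tape_sym list \<Rightarrow> ('a tape_sym \<times> head_move) list \<Rightarrow> ('a tape_sym \<times> head_move) list"
  where "guard rs acts = map2 (\<lambda>s a. if s = Start then (Start, MoveR) else a) rs acts"

lemma read_eq: "(\<lambda>(c, p). c p) = read"
  by (auto simp: read_def)

lemma settle_Start: "c p = Start \<Longrightarrow> settle (c, p) = (c, Suc p)"
  by (auto simp: settle_def read_def idle_def)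

lemma settle_id: "read t \<noteq> Start \<Longrightarrow> settle t = t"
  by (cases t) (auto simp: settle_def read_def idle_def)

lemma settle_funpow_id: "read t \<noteq> Start \<Longrightarrow> (settle ^^ n) t = t"
  by (induction n) (auto simp: settle_id)

lemma map_settle_funpow_id:
  "\<forall>t\<in>set S. read t \<noteq> Start \<Longrightarrow> map (settle ^^ n) S = S"
  by (auto simp: settle_funpow_id intro: map_idI)

lemma act_guard_idle:
  "map2 act_on_tape (guard (map read ts) (map idle (map read ts))) ts = map settle ts"
  by (induction ts) (auto simp: guard_def settle_def idle_def)

lemma act_guard_idle_update:
  assumes "i < length ts" "read (ts ! i) \<noteq> Start"
  shows "map2 act_on_tape (guard (map read ts) ((map idle (map read ts))[i := a])) ts
    = (map settle ts)[i := act_on_tape a (ts ! i)]"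
  using assms
  by (intro nth_equalityI)
     (auto simp: guard_def settle_def idle_def nth_list_update)

text \<open>Initially every head reads \<open>Start\<close>, where \<open>wf_tm\<close> leaves no
  choice but to move right. So the machine itself determines only the new state of the first step,
  and another machine can imitate that step without knowing the input.\<close>

lemma tm_run_1:
  assumes "wf_tm X M"
  shows "tm_run M w 1 = (fst (transition M (start_state M) (replicate (num_tapes M) Start)),
    (init_cells w, 1) # replicate (num_tapes M - 1) (init_cells [], 1))"
proof -
  let ?k = "num_tapes M" and ?rs = "replicate (num_tapes M) Start"
  let ?r = "transition M (start_state M) ?rs"
  have k: "?k \<ge> 1" and rs: "?rs \<in> tm_reads M" and q: "start_state M \<in> states M"
    using assms by (auto simp: wf_tm_def tm_reads_def)
  have len: "length (snd ?r) = ?k" and nth: "\<forall>i<?k. snd ?r ! i = (Start, MoveR)"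
    using assms rs q by (auto simp: wf_tm_def)
  hence acts: "snd ?r = replicate ?k (Start, MoveR)"
    by (intro nth_equalityI) auto
  have ts: "(init_cells w, 0::nat) # replicate (?k - 1) (init_cells [], 0)
      = map (\<lambda>i. (if i = 0 then init_cells w else init_cells [], 0)) [0..<?k]"
    using k by (intro nth_equalityI) (auto simp: nth_Cons')
  have rd: "map (\<lambda>(c, p). c p) ((init_cells w, 0::nat) # replicate (?k - 1) (init_cells [], 0)) = ?rs"
    using k by (intro nth_equalityI) (auto simp: nth_Cons' init_cells_def)
  have upd: "(init_cells v)(0 := Start) = init_cells v" for v :: "'a list"
    by (auto simp: init_cells_def)
  have "map2 act_on_tape (replicate ?k (Start, MoveR))
      ((init_cells w, 0) # replicate (?k - 1) (init_cells [], 0))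
    = (init_cells w, 1) # replicate (?k - 1) (init_cells [], 1)"
    using k by (intro nth_equalityI) (auto simp: nth_Cons' upd)
  moreover have "tm_run M w 1 = tm_step M (Run (start_state M),
      (init_cells w, 0) # replicate (?k - 1) (init_cells [], 0))"
    by (simp add: tm_run_def init_config_def)
  ultimately show ?thesis
    by (simp only: tm_step.simps Let_def rd acts)
qed

section \<open>Halting, running time and reachable configurations\<close>

definition halting :: "tm_state set" where
  "halting = {Yes, No, Halt}"

lemma tm_step_halting: "fst C \<in> halting \<Longrightarrow> tm_step M C = C"
  by (cases C) (auto simp: halting_def)

lemma tm_steps_halting: "fst C \<in> halting \<Longrightarrow> (tm_step M ^^ n) C = C"
  by (induction n) (auto simp: tm_step_halting)

lemma not_halting_iff: "s \<notin> halting \<longleftrightarrow> (\<exists>q. s = Run q)"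
  by (cases s) (auto simp: halting_def)

lemma tm_run_halting_le:
  assumes "fst (tm_run M w m) \<in> halting" "m \<le> n"
  shows "tm_run M w n = tm_run M w m"
proof -
  have "n = (n - m) + m" using assms by simp
  hence "tm_run M w n = (tm_step M ^^ (n - m)) (tm_run M w m)"
    unfolding tm_run_def by (metis funpow_add o_apply)
  thus ?thesis using tm_steps_halting assms by metis
qed

lemma tm_decides_time:
  assumes "tm_decides M X L" "w \<in> lists X"
  shows "fst (tm_run M w (tm_time M w)) = (if w \<in> L then Yes else No)"
    and "m < tm_time M w \<Longrightarrow> \<exists>q. fst (tm_run M w m) = Run q"
    and "tm_time M w \<ge> 1"
proof -
  from assms obtain n where n: "fst (tm_run M w n) = (if w \<in> L then Yes else No)"
    by (auto simp: tm_decides_def)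
  hence h: "fst (tm_run M w n) \<in> halting" by (auto simp: halting_def)
  have ht: "fst (tm_run M w (tm_time M w)) \<in> halting"
    unfolding tm_time_def halting_def using h[unfolded halting_def] by (rule LeastI)
  have "tm_time M w \<le> n"
    unfolding tm_time_def using h[unfolded halting_def] by (rule Least_le)
  with tm_run_halting_le[OF ht this] n
  show "fst (tm_run M w (tm_time M w)) = (if w \<in> L then Yes else No)" by simp
  show "\<exists>q. fst (tm_run M w m) = Run q" if "m < tm_time M w" for m
    using not_less_Least[OF that[unfolded tm_time_def]] not_halting_iff
    by (auto simp: halting_def)
  have "tm_time M w \<noteq> 0"
    using ht by (intro notI) (simp add: tm_run_def init_config_def halting_def)
  thus "tm_time M w \<ge> 1" by simp
qed

lemma tm_time_le: "fst (tm_run M w n) \<in> halting \<Longrightarrow> tm_time M w \<le> n"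
  unfolding tm_time_def halting_def by (rule Least_le)

text \<open>The domain on which \<open>wf_tm\<close> controls \<open>transition\<close>: outside the
  states and the reads over the tape alphabet nothing is known about it.\<close>

definition valid_config :: "'a tm \<Rightarrow> 'a tm_config \<Rightarrow> bool" where
  "valid_config M C \<longleftrightarrow> fst C \<in> Run ` states M \<union> halting \<and> length (snd C) = num_tapes M \<and>
     (\<forall>t\<in>set (snd C). range (fst t) \<subseteq> tape_alphabet M)"

lemma valid_config_reads:
  "valid_config M C \<Longrightarrow> map read (snd C) \<in> tm_reads M"
  by (auto simp: valid_config_def tm_reads_def read_def)

lemma valid_config_step:
  assumes wf: "wf_tm X M" and C: "valid_config M C"
  shows "valid_config M (tm_step M C)"
proof (cases "fst C \<in> halting")
  case True
  with C show ?thesis by (simp add: tm_step_halting)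
next
  case False
  then obtain q ts where Cq: "C = (Run q, ts)"
    using not_halting_iff by (metis prod.collapse)
  have q: "q \<in> states M" using C by (auto simp: Cq valid_config_def halting_def)
  define r where "r = transition M q (map read ts)"
  have rd: "map read ts \<in> tm_reads M" using valid_config_reads[OF C] by (simp add: Cq)
  have r: "fst r \<in> Run ` states M \<union> halting" "length (snd r) = num_tapes M"
      "fst ` set (snd r) \<subseteq> tape_alphabet M"
    using wf q rd unfolding wf_tm_def r_def halting_def by blast+
  have "fst (act_on_tape a t) i \<in> tape_alphabet M"
    if "a \<in> set (snd r)" "t \<in> set ts" for a t i
  proof -
    obtain s d c p where [simp]: "a = (s, d)" "t = (c, p)" by (cases a; cases t) auto
    have "s \<in> tape_alphabet M" using that r(3) by force
    moreover have "range c \<subseteq> tape_alphabet M" using that C by (force simp: Cq valid_config_def)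
    ultimately show ?thesis by auto
  qed
  thus ?thesis
    using r(1,2) C unfolding Cq valid_config_def
    by (auto simp: read_eq Let_def r_def[symmetric] simp del: act_on_tape.simps
        dest!: set_zip_leftD set_zip_rightD elim!: in_set_zipE)
qed

lemma valid_config_run:
  assumes wf: "wf_tm X M" and w: "w \<in> lists X"
  shows "valid_config M (tm_run M w n)"
proof (induction n)
  case 0
  have "Inp ` X \<subseteq> tape_alphabet M" "Start \<in> tape_alphabet M" "Blank \<in> tape_alphabet M"
    using wf by (auto simp: wf_tm_def)
  hence "range (init_cells w) \<subseteq> tape_alphabet M" "range (init_cells []) \<subseteq> tape_alphabet M"
    using w by (auto simp: init_cells_def)
  thus ?case using wf
    by (auto simp: tm_run_def init_config_def valid_config_def wf_tm_def)
next
  case (Suc n)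
  thus ?case using valid_config_step[OF wf] by (simp add: tm_run_def)
qed

section \<open>A machine composed of a transducer and two given machines\<close>

text \<open>Pending words are stored as codes of letters, which keeps the type free of parameters;
  \<open>to_nat\<close> then yields the numbers that \<open>tm\<close> demands as states. The index
  \<open>b\<close> in \<open>Rewind\<close> and \<open>Sim\<close> tells which of the two machines
  is meant.\<close>

datatype control_state = Scan nat "nat list" "nat list" | Rewind bool | Sim bool nat

instance control_state :: countable by countable_datatype

text \<open>The given machines have an input alphabet of another type, so their symbols become work
  symbols, even for letters and odd for work symbols. \<open>Start\<close> and \<open>Blank\<close>
  are kept, so a fresh tape already is the encoding of a fresh tape.\<close>

fun enc :: "'b::countable tape_sym \<Rightarrow> 'a tape_sym" where
  "enc Start = Start"
| "enc Blank = Blank"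
| "enc (Inp b) = Work (2 * to_nat b)"
| "enc (Work i) = Work (2 * i + 1)"

lemma enc_eq_iff [simp]: "enc x = enc y \<longleftrightarrow> x = y"
  by (cases x; cases y) (auto, presburger+)

lemma inj_enc: "inj enc"
  by (auto intro: injI)

lemma enc_eq_Start_iff [simp]: "enc x = Start \<longleftrightarrow> x = Start"
  by (cases x) auto

lemma enc_neq_Inp [simp]: "enc x \<noteq> Inp a" "Inp a \<noteq> enc x"
  by (cases x; simp)+

definition dec :: "'a tape_sym \<Rightarrow> 'b::countable tape_sym" where
  "dec = inv_into UNIV enc"

lemma dec_enc [simp]: "dec (enc x) = x"
  by (simp add: dec_def inj_enc)

definition emb :: "'b::countable tape \<Rightarrow> 'a tape" where
  "emb t = (enc \<circ> fst t, snd t)"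

lemma read_emb [simp]: "read (emb t) = enc (read t)"
  by (auto simp: emb_def read_def)

lemma act_on_tape_emb: "act_on_tape (apfst enc a) (emb t) = emb (act_on_tape a t)"
  by (cases a; cases t) (auto simp: emb_def fun_eq_iff)

text \<open>
  Tape 0 holds the input; it is followed by the tapes of \<open>M False\<close> and those of \<open>M True\<close>. While
  scanning the input, a transducer with states \<open>Q\<close> writes the input words of both machines.
  If it ends in \<open>Fin\<close>, the machine \<open>M False\<close> is run, and if that accepts, \<open>M True\<close>. In
  \<open>Scan c u v\<close> the words \<open>u\<close> and \<open>v\<close> (of codes of letters) are still to be written.
\<close>

locale composite =
  fixes X :: "'a set" and Y :: "bool \<Rightarrow> 'b::countable set" and M :: "bool \<Rightarrow> 'b tm"
    and Q :: "nat set" and q0 :: nat and nxt :: "nat \<Rightarrow> 'a \<Rightarrow> nat"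
    and out :: "bool \<Rightarrow> nat \<Rightarrow> 'a \<Rightarrow> 'b list" and Fin :: "nat set" and B :: nat
  assumes finite_X: "finite X"
    and wf_M: "wf_tm (Y b) (M b)"
    and finite_Q: "finite Q" and q0: "q0 \<in> Q"
    and nxt: "c \<in> Q \<Longrightarrow> x \<in> X \<Longrightarrow> nxt c x \<in> Q"
    and out: "c \<in> Q \<Longrightarrow> x \<in> X \<Longrightarrow> out b c x \<in> lists (Y b)"
    and out_length: "c \<in> Q \<Longrightarrow> x \<in> X \<Longrightarrow> length (out b c x) \<le> B"
begin

fun drive :: "nat \<Rightarrow> 'a list \<Rightarrow> nat" where
  "drive c [] = c"
| "drive c (x # w) = drive (nxt c x) w"

fun emit :: "bool \<Rightarrow> nat \<Rightarrow> 'a list \<Rightarrow> 'b list" where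
  "emit b c [] = []"
| "emit b c (x # w) = out b c x @ emit b (nxt c x) w"

lemma drive_in: "c \<in> Q \<Longrightarrow> w \<in> lists X \<Longrightarrow> drive c w \<in> Q"
  by (induction w arbitrary: c) (auto simp: nxt)

lemma emit_in: "c \<in> Q \<Longrightarrow> w \<in> lists X \<Longrightarrow> emit b c w \<in> lists (Y b)"
proof (induction w arbitrary: c)
  case (Cons x w)
  thus ?case using out[of c x b] nxt[of c x] by auto
qed auto

lemma emit_length: "c \<in> Q \<Longrightarrow> w \<in> lists X \<Longrightarrow> length (emit b c w) \<le> B * length w"
proof (induction w arbitrary: c)
  case (Cons x w)
  have "length (emit b (nxt c x) w) \<le> B * length w" using Cons nxt by auto
  moreover have "length (out b c x) \<le> B" using Cons out_length by auto
  ultimately show ?case by simp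
qed auto

abbreviation k :: "bool \<Rightarrow> nat" where "k b \<equiv> num_tapes (M b)"

lemma k_pos: "k b \<ge> 1"
  using wf_M[of b] by (auto simp: wf_tm_def)

definition off :: "bool \<Rightarrow> nat" where "off b = (if b then 1 + k False else 1)"

definition seg :: "bool \<Rightarrow> 'c list \<Rightarrow> 'c list" where
  "seg b rs = take (k b) (drop (off b) rs)"

fun lift :: "bool \<Rightarrow> tm_state \<Rightarrow> tm_state" where
  "lift b (Run q) = Run (to_nat (Sim b q))"
| "lift b Yes = (if b then Yes else Run (to_nat (Rewind True)))"
| "lift b No = No"
| "lift b Halt = No"

text \<open>
  When the head of the input tape of \<open>M b\<close> has returned to cell 0, the other heads of \<open>M b\<close> are on
  cell 1, where the first step of \<open>M b\<close> would have moved them. So the step that leaves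
  \<open>Rewind b\<close> is the first step of \<open>M b\<close>.
\<close>

fun delta :: "control_state \<Rightarrow> 'a tape_sym list \<Rightarrow> tm_state \<times> ('a tape_sym \<times> head_move) list" where
  "delta (Scan c u v) rs =
     (if rs ! 0 = Start then (Run (to_nat (Scan c u v)), map idle rs)
      else case u of y # u' \<Rightarrow>
          (Run (to_nat (Scan c u' v)), (map idle rs)[off False := (Work (2 * y), MoveR)])
      | [] \<Rightarrow> (case v of y # v' \<Rightarrow>
          (Run (to_nat (Scan c [] v')), (map idle rs)[off True := (Work (2 * y), MoveR)])
      | [] \<Rightarrow> (case rs ! 0 of Inp x \<Rightarrow>
            (Run (to_nat (Scan (nxt c x) (map to_nat (out False c x)) (map to_nat (out True c x)))),
             (map idle rs)[0 := (rs ! 0, MoveR)])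
          | _ \<Rightarrow> (if c \<in> Fin then Run (to_nat (Rewind False)) else No, map idle rs))))"
| "delta (Rewind b) rs =
     (if rs ! off b = Start
      then (lift b (fst (transition (M b) (start_state (M b)) (replicate (k b) Start))), map idle rs)
      else (Run (to_nat (Rewind b)), (map idle rs)[off b := (rs ! off b, MoveL)]))"
| "delta (Sim b q) rs =
     (if set (seg b rs) \<subseteq> enc ` tape_alphabet (M b)
      then let r = transition (M b) q (map dec (seg b rs)) in
        (lift b (fst r),
         map idle (take (off b) rs) @ map (apfst enc) (snd r) @ map idle (drop (off b + k b) rs))
      else (No, map idle rs))"

definition control_states :: "control_state set" where
  "control_states = (\<lambda>(c, u, v). Scan c u v) `
       (Q \<times> {u. set u \<subseteq> to_nat ` Y False \<and> length u \<le> B} \<times> {v. set v \<subseteq> to_nat ` Y True \<and> length v \<le> B})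
     \<union> range Rewind \<union> (\<Union>b. Sim b ` states (M b))"

definition machine :: "'a tm" where
  "machine = \<lparr>num_tapes = 1 + k False + k True, states = to_nat ` control_states,
     tape_alphabet = {Start, Blank} \<union> Inp ` X \<union> (\<Union>b. enc ` tape_alphabet (M b)),
     start_state = to_nat (Scan q0 [] []),
     transition = (\<lambda>q rs. let r = delta (from_nat q) rs in (fst r, guard rs (snd r)))\<rparr>"

section \<open>The composite machine is well-formed\<close>

lemma machine_simps [simp]:
  "num_tapes machine = 1 + k False + k True" "states machine = to_nat ` control_states"
  "start_state machine = to_nat (Scan q0 [] [])"
  "transition machine (to_nat S) rs = (fst (delta S rs), guard rs (snd (delta S rs)))"
  by (auto simp: machine_def Let_def)

text \<open>Pending words have length at most \<open>B\<close>, and \<open>Y b\<close> is finite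
  since \<open>Inp\<close> embeds it into the finite tape alphabet of \<open>M b\<close>.\<close>

lemma finite_control_states: "finite control_states"
proof -
  have "finite (Y b)" for b
  proof (rule finite_imageD)
    show "finite (Inp ` Y b)" using wf_M[of b] by (auto simp: wf_tm_def intro: finite_subset)
  qed (auto intro: inj_onI)
  moreover have "finite (states (M b))" for b using wf_M[of b] by (auto simp: wf_tm_def)
  ultimately show ?thesis unfolding control_states_def
    by (intro finite_UnI finite_imageI finite_cartesian_product finite_Q finite_lists_length_le) auto
qed

lemma enc_in_alphabet:
  assumes "s \<in> tape_alphabet (M b)"
  shows "enc s \<in> tape_alphabet machine"
proof -
  have "enc s \<in> enc ` tape_alphabet (M b)" using assms by (rule imageI)
  thus ?thesis unfolding machine_def tm.select_convs by (intro UnI2 UN_I[of b]) simp_all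
qed

lemma Scan_in_states:
  "\<lbrakk>c \<in> Q; set u \<subseteq> to_nat ` Y False; length u \<le> B; set v \<subseteq> to_nat ` Y True; length v \<le> B\<rbrakk>
    \<Longrightarrow> Scan c u v \<in> control_states"
  unfolding control_states_def by (intro UnI1 image_eqI[of _ _ "(c, u, v)"]) auto

lemma lift_in:
  assumes "s \<in> Run ` states (M b) \<union> halting"
  shows "lift b s \<in> Run ` states machine \<union> {Yes, No, Halt}"
proof -
  have "Rewind b' \<in> control_states" "q \<in> states (M b') \<Longrightarrow> Sim b' q \<in> control_states" for b' q
    by (auto simp: control_states_def)
  thus ?thesis using assms by (cases s) (auto simp: halting_def)
qed

text \<open>All reads over the joint tape alphabet have to be covered, also those that no run
  produces. This is why the \<open>Sim\<close> clause of \<open>delta\<close> first tests that the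
  symbols on the tapes of \<open>M b\<close> are encoded symbols of \<open>M b\<close>: only then
  does \<open>wf_M\<close> say anything about the simulated transition.\<close>

lemma delta_wf:
  assumes S: "S \<in> control_states" and rs: "rs \<in> tm_reads machine"
  shows "fst (delta S rs) \<in> Run ` states machine \<union> {Yes, No, Halt}"
    and "length (snd (delta S rs)) = num_tapes machine"
    and "fst ` set (snd (delta S rs)) \<subseteq> tape_alphabet machine"
proof -
  have len: "length rs = 1 + k False + k True" and rs_in: "set rs \<subseteq> tape_alphabet machine"
    using rs by (auto simp: tm_reads_def)
  have idle: "fst ` set (map idle xs) \<subseteq> tape_alphabet machine" if "set xs \<subseteq> set rs" for xs
    using rs_in that by (auto simp: idle_def)
  have upd: "fst ` set ((map idle rs)[i := (s, d)]) \<subseteq> tape_alphabet machine"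
    if "s \<in> tape_alphabet machine" for s d i
    using set_update_subset_insert[of "map idle rs" i "(s, d)"] idle[of rs] that by fastforce
  have encY: "Work (2 * y) \<in> tape_alphabet machine" if y: "y \<in> to_nat ` Y b" for y b
  proof -
    obtain z where z: "y = to_nat z" "z \<in> Y b" using y by auto
    hence "Inp z \<in> tape_alphabet (M b)" using wf_M[of b] by (auto simp: wf_tm_def)
    from enc_in_alphabet[OF this]
    show ?thesis by (simp add: z)
  qed
  have read0: "rs ! i \<in> tape_alphabet machine" if "i < length rs" for i
    using rs_in that by auto
  have offk: "off b < length rs" "off b + k b \<le> length rs" for b
    using k_pos[of b] by (auto simp: len off_def)
  have start: "fst (transition (M b) (start_state (M b)) (replicate (k b) Start)) \<in> Run ` states (M b) \<union> halting" for b
    using wf_M[of b] by (auto simp: wf_tm_def tm_reads_def halting_def)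
  have sim: "fst r \<in> Run ` states (M b) \<union> halting \<and> length (snd r) = k b \<and>
      fst ` set (snd r) \<subseteq> tape_alphabet (M b)"
    if "S = Sim b q" "set (seg b rs) \<subseteq> enc ` tape_alphabet (M b)"
      "r = transition (M b) q (map dec (seg b rs))" for b q r
  proof -
    have "map dec (seg b rs) \<in> tm_reads (M b)"
      using that(2) offk(2)[of b] by (auto simp: tm_reads_def seg_def)
    moreover have "q \<in> states (M b)" using S that by (auto simp: control_states_def)
    ultimately show ?thesis using wf_M[of b] unfolding wf_tm_def that(3) halting_def by blast
  qed
  have inX: "x \<in> X" if "rs ! 0 = Inp x" for x
    using read0[of 0] that len by (auto simp: machine_def)
  show "fst (delta S rs) \<in> Run ` states machine \<union> {Yes, No, Halt}"
  proof (cases S)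
    case (Scan c u v)
    with S have c: "c \<in> Q" and u: "set u \<subseteq> to_nat ` Y False" "length u \<le> B" and v: "set v \<subseteq> to_nat ` Y True" "length v \<le> B"
      by (auto simp: control_states_def)
    note * = Scan_in_states
    let ?R = "Run ` to_nat ` control_states"
    have "Rewind False \<in> control_states" by (auto simp: control_states_def)
    hence 1: "Run (to_nat (Rewind False)) \<in> ?R" by (intro imageI)
    have 2: "Run (to_nat (Scan c u v)) \<in> ?R"
      by (intro imageI *) (use c u v in auto)
    have 3: "Run (to_nat (Scan c u' v)) \<in> ?R" if "u = y # u'" for y u'
      by (intro imageI *) (use c u v that in auto)
    have 4: "Run (to_nat (Scan c [] v')) \<in> ?R" if "v = y # v'" for y v'
      by (intro imageI *) (use c u v that in auto)
    have 5: "Run (to_nat (Scan (nxt c x) (map to_nat (out False c x)) (map to_nat (out True c x)))) \<in> ?R"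
      if "rs ! 0 = Inp x" for x
    proof -
      have "set (out b c x) \<subseteq> Y b" for b using out[OF c inX[OF that], of b] by auto
      thus ?thesis using inX[OF that] c nxt out_length by (intro imageI *) auto
    qed
    show ?thesis unfolding Scan machine_simps using 1 2 3 4 5
      by (cases u; cases v; cases "rs ! 0") simp_all
  next
    case (Rewind b)
    have "Rewind b \<in> control_states" by (auto simp: control_states_def)
    thus ?thesis using Rewind lift_in[OF start[of b]] by auto
  next
    case (Sim b q)
    thus ?thesis using lift_in sim[OF Sim] by (auto simp: Let_def)
  qed
  show "length (snd (delta S rs)) = num_tapes machine"
    using sim offk len
    by (cases S) (auto simp: Let_def off_def split: list.splits tape_sym.splits)
  show "fst ` set (snd (delta S rs)) \<subseteq> tape_alphabet machine"
  proof (cases S)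
    case (Scan c u v)
    with S have u: "set u \<subseteq> to_nat ` Y False" and v: "set v \<subseteq> to_nat ` Y True"
      by (auto simp: control_states_def)
    define P where "P acts \<longleftrightarrow> fst ` set acts \<subseteq> tape_alphabet machine"
      for acts :: "('a tape_sym \<times> head_move) list"
    have 1: "P (map idle rs)" unfolding P_def by (rule idle) simp
    have 2: "P ((map idle rs)[i := (Work (2 * y), d)])" if "u = y # u'" for i y u' d
      unfolding P_def by (intro upd encY[of _ False]) (use u that in auto)
    have 3: "P ((map idle rs)[i := (Work (2 * y), d)])" if "v = y # v'" for i y v' d
      unfolding P_def by (intro upd encY[of _ True]) (use v that in auto)
    have 4: "P ((map idle rs)[0 := (rs ! 0, d)])" for d
      unfolding P_def by (intro upd read0) (simp add: len)
    show ?thesis unfolding Scan P_def[symmetric] using 1 2 3 4[of MoveR]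
      by (cases u; cases v; cases "rs ! 0") simp_all
  next
    case (Rewind b)
    thus ?thesis using idle[OF order.refl] upd[OF read0[OF offk(1)[of b]]] by auto
  next
    case (Sim b q)
    show ?thesis
    proof (cases "set (seg b rs) \<subseteq> enc ` tape_alphabet (M b)")
      case True
      define r where "r = transition (M b) q (map dec (seg b rs))"
      have "fst ` set (snd r) \<subseteq> tape_alphabet (M b)" using sim[OF Sim True r_def] by blast
      hence "fst ` set (map (apfst enc) (snd r)) \<subseteq> tape_alphabet machine"
        using enc_in_alphabet[of _ b] by force
      moreover have "snd (delta S rs) =
         map idle (take (off b) rs) @ map (apfst enc) (snd r) @ map idle (drop (off b + k b) rs)"
        using True by (simp add: Sim Let_def r_def)
      ultimately show ?thesis
        using idle[of "take (off b) rs"] idle[of "drop (off b + k b) rs"]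
        by (simp add: image_Un set_take_subset set_drop_subset)
    next
      case False
      thus ?thesis using idle[OF order.refl] by (simp add: Sim)
    qed
  qed
qed

lemma wf_machine: "wf_tm X machine"
proof -
  have fin: "finite (tape_alphabet machine)"
    using finite_X wf_M by (auto simp: machine_def wf_tm_def)
  have s: "Scan q0 [] [] \<in> control_states" by (intro Scan_in_states q0) auto
  have g: "fst ` set (guard rs acts) \<subseteq> insert Start (fst ` set acts)" for rs :: "'a tape_sym list" and acts
    by (auto simp: guard_def elim!: in_set_zipE split: if_splits)
  have "Start \<in> tape_alphabet machine" by (auto simp: machine_def)
  hence "fst (transition machine q rs) \<in> Run ` states machine \<union> {Yes, No, Halt} \<and>
        length (snd (transition machine q rs)) = num_tapes machine \<and>
        fst ` set (snd (transition machine q rs)) \<subseteq> tape_alphabet machine \<and>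
        (\<forall>i<num_tapes machine. rs ! i = Start \<longrightarrow> snd (transition machine q rs) ! i = (Start, MoveR))"
    if q: "q \<in> states machine" and rs: "rs \<in> tm_reads machine" for q rs
  proof -
    obtain S where S: "q = to_nat S" "S \<in> control_states" using q by auto
    have len: "length rs = num_tapes machine" using rs by (auto simp: tm_reads_def)
    note d = delta_wf[OF S(2) rs]
    have "insert Start (fst ` set (snd (delta S rs))) \<subseteq> tape_alphabet machine"
      using d(3) \<open>Start \<in> _\<close> by simp
    with g[of rs "snd (delta S rs)"]
    have "fst ` set (guard rs (snd (delta S rs))) \<subseteq> tape_alphabet machine"
      by (rule order.trans)
    hence "fst ` set (snd (transition machine q rs)) \<subseteq> tape_alphabet machine"
      by (simp only: S(1) machine_simps snd_conv)
    thus ?thesis using d(1,2) len by (auto simp: S(1) guard_def)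
  qed
  thus ?thesis using fin finite_control_states s
    by (auto simp: wf_tm_def) (auto simp: machine_def)
qed

text \<open>\<open>T\<close> holds the tapes of the machine \<open>M b\<close> under consideration
  and \<open>S\<close> those of the other one, so that a single set of lemmas serves both
  machines.\<close>

definition layout :: "bool \<Rightarrow> 'a tape \<Rightarrow> 'a tape list \<Rightarrow> 'a tape list \<Rightarrow> 'a tape list" where
  "layout b t0 T S = t0 # (if b then S @ T else T @ S)"

lemma layout_swap: "layout b t0 T S = layout (\<not> b) t0 S T"
  by (auto simp: layout_def)

lemma length_layout [simp]: "length (layout b t0 T S) = Suc (length T + length S)"
  by (auto simp: layout_def)

lemma map_layout: "map f (layout b t0 T S) = f t0 # (if b then map f S @ map f T else map f T @ map f S)"
  by (auto simp: layout_def)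

lemma layout_nth_off:
  assumes "length S = k (\<not> b)" "length T = k b"
  shows "layout b t0 T S ! off b = T ! 0"
  using assms k_pos[of b] by (auto simp: layout_def off_def nth_append)

lemma layout_update_off:
  assumes "length S = k (\<not> b)" "length T = k b"
  shows "(layout b t0 T S)[off b := t] = layout b t0 (T[0 := t]) S"
  using assms k_pos[of b] by (auto simp: layout_def off_def list_update_append)

lemma step_idle:
  assumes "delta S (map read ts) = (s, map idle (map read ts))"
  shows "tm_step machine (Run (to_nat S), ts) = (s, map settle ts)"
  using assms by (simp add: read_eq Let_def act_guard_idle del: map_map)

lemma step_update:
  assumes "delta S (map read ts) = (s, (map idle (map read ts))[i := a])"
    "i < length ts" "read (ts ! i) \<noteq> Start"
  shows "tm_step machine (Run (to_nat S), ts) = (s, (map settle ts)[i := act_on_tape a (ts ! i)])"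
  using assms by (simp add: read_eq Let_def act_guard_idle_update del: map_map)

text \<open>The tapes of \<open>M b\<close> during the scan, when \<open>u\<close> has been written
  so far: the first head waits on the blank after \<open>u\<close>, the others on cell 1. No head is
  on \<open>Start\<close>, so idling changes nothing.\<close>

definition parked :: "bool \<Rightarrow> 'b list \<Rightarrow> 'a tape list" where
  "parked b u = emb (init_cells u, Suc (length u)) # replicate (k b - 1) (emb (init_cells ([] :: 'b list), 1))"

lemma length_parked [simp]: "length (parked b u) = k b"
  using k_pos[of b] by (auto simp: parked_def)

lemma parked_read: "t \<in> set (parked b u) \<Longrightarrow> read t \<noteq> Start"
  by (auto simp: parked_def) (auto simp: read_def init_cells_def)

lemma parked_settle [simp]: "map settle (parked b u) = parked b u"
  by (intro map_idI settle_id parked_read)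

lemma parked_append:
  "(parked b u)[0 := act_on_tape (Work (2 * to_nat y), MoveR) (parked b u ! 0)] = parked b (u @ [y])"
  by (auto simp: parked_def emb_def init_cells_def fun_eq_iff nth_append)

lemma map_settle_layout:
  "map settle (layout b t0 T S) = layout b (settle t0) (map settle T) (map settle S)"
  by (auto simp: layout_def)

section \<open>The scanning phase of a run\<close>

lemma step_emit_False:
  assumes "read t0 \<noteq> Start"
  shows "tm_step machine (Run (to_nat (Scan c (to_nat y # u) v)), layout False t0 (parked False p) (parked True p'))
     = (Run (to_nat (Scan c u v)), layout False t0 (parked False (p @ [y])) (parked True p'))"
proof -
  let ?ts = "layout False t0 (parked False p) (parked True p')"
  have o: "off False < length ?ts" using k_pos[of False] by (auto simp: off_def)
  have n: "?ts ! off False = parked False p ! 0" by (rule layout_nth_off) auto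
  have r: "read (?ts ! off False) \<noteq> Start"
    unfolding n using k_pos[of False] by (intro parked_read[of _ False p]) auto
  have "delta (Scan c (to_nat y # u) v) (map read ?ts) = (Run (to_nat (Scan c u v)),
      (map idle (map read ?ts))[off False := (Work (2 * to_nat y), MoveR)])"
    using assms by (simp add: layout_def)
  from step_update[OF this o r]
  show ?thesis unfolding n
    by (simp add: map_settle_layout settle_id assms layout_update_off parked_append)
qed

lemma step_emit_True:
  assumes "read t0 \<noteq> Start"
  shows "tm_step machine (Run (to_nat (Scan c [] (to_nat y # v))), layout False t0 (parked False p) (parked True p'))
     = (Run (to_nat (Scan c [] v)), layout False t0 (parked False p) (parked True (p' @ [y])))"
proof -
  let ?ts = "layout True t0 (parked True p') (parked False p)"
  have o: "off True < length ?ts" using k_pos[of True] by (auto simp: off_def)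
  have n: "?ts ! off True = parked True p' ! 0" by (rule layout_nth_off) auto
  have r: "read (?ts ! off True) \<noteq> Start"
    unfolding n using k_pos[of True] by (intro parked_read[of _ True p']) auto
  have "delta (Scan c [] (to_nat y # v)) (map read ?ts) = (Run (to_nat (Scan c [] v)),
      (map idle (map read ?ts))[off True := (Work (2 * to_nat y), MoveR)])"
    using assms by (simp add: layout_def)
  from step_update[OF this o r]
  show ?thesis unfolding n layout_swap[of False]
    by (simp add: map_settle_layout settle_id assms layout_update_off parked_append)
qed

lemma steps_emit_False:
  assumes "read t0 \<noteq> Start"
  shows "(tm_step machine ^^ length u)
      (Run (to_nat (Scan c (map to_nat u) v)), layout False t0 (parked False p) (parked True p'))
     = (Run (to_nat (Scan c [] v)), layout False t0 (parked False (p @ u)) (parked True p'))"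
proof (induction u arbitrary: p)
  case (Cons y u)
  show ?case
    using Cons[of "p @ [y]"] by (simp add: funpow_swap1[symmetric] step_emit_False[OF assms] funpow_Suc_right del: tm_step.simps funpow.simps)
qed simp

lemma steps_emit_True:
  assumes "read t0 \<noteq> Start"
  shows "(tm_step machine ^^ length v)
      (Run (to_nat (Scan c [] (map to_nat v))), layout False t0 (parked False p) (parked True p'))
     = (Run (to_nat (Scan c [] [])), layout False t0 (parked False p) (parked True (p' @ v)))"
proof (induction v arbitrary: p')
  case (Cons y v)
  show ?case
    using Cons[of "p' @ [y]"] by (simp add: step_emit_True[OF assms] funpow_Suc_right del: tm_step.simps funpow.simps)
qed simp

text \<open>The head position is \<open>Suc i\<close> because cell 0 holds \<open>Start\<close>,
  which puts \<open>w ! i\<close> into cell \<open>Suc i\<close>.\<close>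

definition scanned :: "'a list \<Rightarrow> nat \<Rightarrow> 'a tape" where
  "scanned w i = (init_cells w, Suc i)"

lemma scanned_read: "read (scanned w i) = (if i < length w then Inp (w ! i) else Blank)"
  by (auto simp: scanned_def read_def init_cells_def)

lemma step_read_letter:
  assumes "i < length w"
  shows "tm_step machine (Run (to_nat (Scan c [] [])), layout False (scanned w i) (parked False p) (parked True p'))
    = (Run (to_nat (Scan (nxt c (w ! i)) (map to_nat (out False c (w ! i))) (map to_nat (out True c (w ! i))))),
       layout False (scanned w (Suc i)) (parked False p) (parked True p'))"
proof -
  let ?ts = "layout False (scanned w i) (parked False p) (parked True p')"
  have n: "?ts ! 0 = scanned w i" by (simp add: layout_def)
  have r: "read (?ts ! 0) \<noteq> Start" using assms by (simp add: n scanned_read)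
  have "delta (Scan c [] []) (map read ?ts) =
     (Run (to_nat (Scan (nxt c (w ! i)) (map to_nat (out False c (w ! i))) (map to_nat (out True c (w ! i))))),
      (map idle (map read ?ts))[0 := (Inp (w ! i), MoveR)])"
    using assms by (simp add: layout_def scanned_read)
  from step_update[OF this _ r]
  show ?thesis unfolding n using assms
    by (auto simp: map_settle_layout layout_def scanned_def init_cells_def fun_eq_iff)
qed

definition scan_time :: "nat \<Rightarrow> 'a list \<Rightarrow> nat" where
  "scan_time c w = length w + length (emit False c w) + length (emit True c w)"

lemma steps_scan:
  assumes "w = w1 @ w2"
  shows "(tm_step machine ^^ scan_time c w2)
      (Run (to_nat (Scan c [] [])), layout False (scanned w (length w1)) (parked False p) (parked True p'))
    = (Run (to_nat (Scan (drive c w2) [] [])),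
       layout False (scanned w (length w)) (parked False (p @ emit False c w2)) (parked True (p' @ emit True c w2)))"
  using assms
proof (induction w2 arbitrary: w1 c p p')
  case (Cons x w2)
  let ?u = "out False c x" and ?v = "out True c x" and ?c = "nxt c x"
  have r: "read (scanned w i) \<noteq> Start" for w i by (simp add: scanned_read)
  have t: "scan_time c (x # w2) = scan_time ?c w2 + (length ?v + (length ?u + Suc 0))"
    by (simp add: scan_time_def)
  have "(tm_step machine ^^ Suc 0)
      (Run (to_nat (Scan c [] [])), layout False (scanned w (length w1)) (parked False p) (parked True p'))
    = (Run (to_nat (Scan ?c (map to_nat ?u) (map to_nat ?v))),
       layout False (scanned w (Suc (length w1))) (parked False p) (parked True p'))"
    using step_read_letter[of "length w1" w c p p'] Cons.prems by simp
  thus ?case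
    using Cons.IH[of "w1 @ [x]" ?c "p @ ?u" "p' @ ?v"] Cons.prems unfolding t funpow_add o_apply
    by (simp add: steps_emit_False[OF r] steps_emit_True[OF r] del: tm_step.simps funpow.simps)
qed (simp add: scan_time_def)

lemma steps_to_scan:
  "(tm_step machine ^^ Suc (scan_time q0 w)) (init_config machine w)
    = (Run (to_nat (Scan (drive q0 w) [] [])),
       layout False (scanned w (length w)) (parked False (emit False q0 w)) (parked True (emit True q0 w)))"
proof -
  let ?ts = "(init_cells w, 0) # replicate (k False + k True) (init_cells [], 0)"
  \<comment> \<open>The first step only takes all heads from cell 0 to cell 1; it accounts for the
    \<open>Suc\<close> in the number of steps.\<close>
  have "delta (Scan q0 [] []) (map read ?ts) = (Run (to_nat (Scan q0 [] [])), map idle (map read ?ts))"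
    by (simp add: read_def init_cells_def)
  from step_idle[OF this]
  have "tm_step machine (init_config machine w) = (Run (to_nat (Scan q0 [] [])), map settle ?ts)"
    by (simp add: init_config_def)
  also have "map settle ?ts = layout False (scanned w 0) (parked False []) (parked True [])"
  proof -
    have e: "emb (init_cells ([]::'b list), Suc 0) = (init_cells [], Suc 0)"
      by (auto simp: emb_def init_cells_def fun_eq_iff)
    have "parked b [] = replicate (k b) (init_cells [], Suc 0)" for b
      using k_pos[of b] by (simp add: parked_def e flip: replicate_Suc)
    thus ?thesis
      by (simp add: layout_def settle_Start scanned_def init_cells_def replicate_add)
  qed
  finally show ?thesis
    using steps_scan[of w "[]" w q0 "[]" "[]"]
    by (simp add: funpow_Suc_right del: funpow.simps)
qed

lemma step_scan_end:
  "tm_step machine (Run (to_nat (Scan c [] [])),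
      layout False (scanned w (length w)) (parked False p) (parked True p'))
    = (if c \<in> Fin then Run (to_nat (Rewind False)) else No,
       layout False (scanned w (length w)) (parked False p) (parked True p'))"
proof -
  let ?ts = "layout False (scanned w (length w)) (parked False p) (parked True p')"
  have "delta (Scan c [] []) (map read ?ts) =
      (if c \<in> Fin then Run (to_nat (Rewind False)) else No, map idle (map read ?ts))"
    by (simp add: layout_def scanned_read)
  from step_idle[OF this] show ?thesis
    by (simp add: map_settle_layout settle_id scanned_read)
qed

section \<open>Rewinding and simulating one of the given machines\<close>

definition rewinding :: "bool \<Rightarrow> 'b list \<Rightarrow> nat \<Rightarrow> 'a tape list" where
  "rewinding b u j = emb (init_cells u, j) # replicate (k b - 1) (emb (init_cells ([] :: 'b list), 1))"

lemma length_rewinding [simp]: "length (rewinding b u j) = k b"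
  using k_pos[of b] by (auto simp: rewinding_def)

text \<open>The passive tapes \<open>S\<close> are arbitrary and may have a head on
  \<open>Start\<close>, which is forced to the right; hence the iterates of \<open>settle\<close>
  instead of the unchanged tapes.\<close>

lemma steps_rewind:
  assumes "length S = k (\<not> b)"
  shows "(tm_step machine ^^ j) (Run (to_nat (Rewind b)), layout b t0 (rewinding b u j) S)
    = (Run (to_nat (Rewind b)), layout b ((settle ^^ j) t0) (rewinding b u 0) (map (settle ^^ j) S))"
  using assms
proof (induction j arbitrary: t0 S)
  case (Suc j)
  let ?ts = "layout b t0 (rewinding b u (Suc j)) S"
  have o: "off b < length ?ts" using k_pos[of b] Suc.prems by (auto simp: off_def)
  have n: "?ts ! off b = emb (init_cells u, Suc j)"
    using Suc.prems k_pos[of b] by (subst layout_nth_off) (auto simp: rewinding_def)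
  have r: "read (?ts ! off b) \<noteq> Start"
    unfolding n read_emb enc_eq_Start_iff by (simp add: read_def init_cells_def)
  have "delta (Rewind b) (map read ?ts) = (Run (to_nat (Rewind b)),
      (map idle (map read ?ts))[off b := (read (?ts ! off b), MoveL)])"
    using r o by simp
  from step_update[OF this o r]
  have "tm_step machine (Run (to_nat (Rewind b)), ?ts)
      = (Run (to_nat (Rewind b)), layout b (settle t0) ((map settle (rewinding b u (Suc j)))
          [0 := act_on_tape (read (emb (init_cells u, Suc j)), MoveL) (emb (init_cells u, Suc j))]) (map settle S))"
    unfolding n using Suc.prems by (simp add: map_settle_layout layout_update_off)
  also have "(map settle (rewinding b u (Suc j)))
      [0 := act_on_tape (read (emb (init_cells u, Suc j)), MoveL) (emb (init_cells u, Suc j))]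
      = rewinding b u j"
  proof -
    have "settle (emb (init_cells ([]::'b list), Suc 0)) = (emb (init_cells ([]::'b list), Suc 0) :: 'a tape)"
      by (intro settle_id) (simp only: read_emb enc_eq_Start_iff, simp add: read_def init_cells_def)
    moreover have "act_on_tape (read (emb (init_cells u, Suc j)), MoveL) (emb (init_cells u, Suc j))
        = (emb (init_cells u, j) :: 'a tape)"
      by (auto simp: emb_def read_def fun_eq_iff)
    ultimately show ?thesis by (simp add: rewinding_def)
  qed
  finally show ?case
    using Suc.IH[of "map settle S" "settle t0"] Suc.prems
    by (simp add: funpow_Suc_right o_def del: funpow.simps tm_step.simps)
qed simp

text \<open>By \<open>tm_run_1\<close> the first step of \<open>M b\<close> changes no cell. With
  the first head back on cell 0 and the others already on cell 1, idling moves all heads to where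
  \<open>M b\<close> would have them.\<close>

lemma step_start:
  assumes "length S = k (\<not> b)"
  shows "tm_step machine (Run (to_nat (Rewind b)), layout b t0 (rewinding b u 0) S)
    = (lift b (fst (tm_run (M b) u 1)), layout b (settle t0) (map emb (snd (tm_run (M b) u 1))) (map settle S))"
proof -
  let ?ts = "layout b t0 (rewinding b u 0) S"
  have o: "off b < length ?ts" using k_pos[of b] assms by (auto simp: off_def)
  have n: "?ts ! off b = emb (init_cells u, 0)"
    using assms k_pos[of b] by (subst layout_nth_off) (auto simp: rewinding_def)
  have "delta (Rewind b) (map read ?ts) =
      (lift b (fst (transition (M b) (start_state (M b)) (replicate (k b) Start))), map idle (map read ?ts))"
    using o by (simp add: n) (simp add: read_def init_cells_def)
  from step_idle[OF this]
  have "tm_step machine (Run (to_nat (Rewind b)), ?ts) = (lift b (fst (tm_run (M b) u 1)),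
      layout b (settle t0) (map settle (rewinding b u 0)) (map settle S))"
    by (simp add: tm_run_1[OF wf_M, unfolded One_nat_def] map_settle_layout del: tm_step.simps delta.simps)
  also have "map settle (rewinding b u 0) = map emb (snd (tm_run (M b) u 1))"
  proof -
    have "settle (emb (init_cells ([]::'b list), Suc 0)) = (emb (init_cells ([]::'b list), Suc 0) :: 'a tape)"
      by (intro settle_id) (simp only: read_emb enc_eq_Start_iff, simp add: read_def init_cells_def)
    moreover have "settle (emb (init_cells u, 0)) = (emb (init_cells u, Suc 0) :: 'a tape)"
      unfolding emb_def by (simp add: settle_Start init_cells_def)
    ultimately show ?thesis by (simp add: tm_run_1[OF wf_M, unfolded One_nat_def] rewinding_def)
  qed
  finally show ?thesis .
qed

lemma step_sim:
  assumes C: "valid_config (M b) (Run q, T)" and S: "length S = k (\<not> b)"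
  shows "tm_step machine (lift b (Run q), layout b t0 (map emb T) S)
    = (lift b (fst (tm_step (M b) (Run q, T))),
       layout b (settle t0) (map emb (snd (tm_step (M b) (Run q, T)))) (map settle S))"
proof -
  let ?ts = "layout b t0 (map emb T) S"
  have q: "q \<in> states (M b)" and T: "length T = k b" using C by (auto simp: valid_config_def halting_def)
  have rd: "map read T \<in> tm_reads (M b)" using valid_config_reads[OF C] by simp
  define r where "r = transition (M b) q (map read T)"
  have lr: "length (snd r) = k b" and sr: "\<And>i. i < k b \<Longrightarrow> read (T ! i) = Start \<Longrightarrow> snd r ! i = (Start, MoveR)"
    using wf_M[of b] q rd T unfolding wf_tm_def r_def by auto
  have seg: "seg b (map read ?ts) = map enc (map read T)"
    using T S by (auto simp: seg_def map_layout off_def)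
  have "set (seg b (map read ?ts)) \<subseteq> enc ` tape_alphabet (M b)"
    using rd unfolding seg by (auto simp: tm_reads_def)
  moreover have "map dec (map enc (map read T) :: 'a tape_sym list) = map read T" by (simp add: o_def)
  ultimately have d: "delta (Sim b q) (map read ?ts) = (lift b (fst r),
     map idle (take (off b) (map read ?ts)) @ map (apfst enc) (snd r) @ map idle (drop (off b + k b) (map read ?ts)))"
    by (simp only: delta.simps seg r_def if_True Let_def)
  have g: "map2 act_on_tape (guard (map read us) (map idle (map read us))) us = map settle us" for us :: "'a tape list"
    by (rule act_guard_idle)
  \<comment> \<open>\<open>guard\<close> does not interfere with the encoded actions:
    \<open>M b\<close> is well-formed and \<open>enc\<close> respects \<open>Start\<close>, so on
    \<open>Start\<close> the action is the prescribed one anyway.\<close>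
  have e: "map2 act_on_tape (guard (map read (map emb T)) (map (apfst enc) (snd r))) (map emb T)
     = map emb (map2 act_on_tape (snd r) T)"
    using T lr sr by (intro nth_equalityI) (auto simp: guard_def act_on_tape_emb[symmetric])
  have app: "map2 act_on_tape (guard (map read us @ rs) (as @ bs)) (us @ vs)
     = map2 act_on_tape (guard (map read us) as) us @ map2 act_on_tape (guard rs bs) vs"
    if "length as = length us" for us vs :: "'a tape list" and rs as bs
    using that by (simp add: guard_def)
  let ?P = "if b then t0 # S else [t0]" and ?R = "if b then [] else S"
  have ts: "?ts = ?P @ map emb T @ ?R" by (simp add: layout_def)
  have oP: "off b = length ?P" using S by (simp add: off_def)
  have "take (off b) (map read ?ts) = map read ?P" "drop (off b + k b) (map read ?ts) = map read ?R"
    unfolding ts oP using T by auto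
  hence "map2 act_on_tape (guard (map read ?ts) (snd (delta (Sim b q) (map read ?ts)))) ?ts
     = map2 act_on_tape (guard (map read ?P @ map read (map emb T) @ map read ?R)
         (map idle (map read ?P) @ map (apfst enc) (snd r) @ map idle (map read ?R))) (?P @ map emb T @ ?R)"
    unfolding d snd_conv by (simp only: ts map_append)
  also have "\<dots> = map settle ?P @ map emb (map2 act_on_tape (snd r) T) @ map settle ?R"
    using T lr by (simp only: app length_map g e)
  also have "\<dots> = layout b (settle t0) (map emb (map2 act_on_tape (snd r) T)) (map settle S)"
    by (simp add: layout_def)
  finally show ?thesis
    by (simp add: read_eq Let_def d r_def del: map_map delta.simps)
qed

text \<open>The simulation begins after the first step of \<open>M b\<close>, whence the shift by
  one. That \<open>M b\<close> is still running is essential: once it halts, its own configuration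
  stays put, while \<open>lift\<close> may send the composite on to the next phase.\<close>

lemma steps_sim:
  assumes "w \<in> lists (Y b)" "length S = k (\<not> b)"
    and "\<And>m. m < n \<Longrightarrow> \<exists>q. fst (tm_run (M b) w (Suc m)) = Run q"
  shows "(tm_step machine ^^ n)
      (lift b (fst (tm_run (M b) w 1)), layout b t0 (map emb (snd (tm_run (M b) w 1))) S)
    = (lift b (fst (tm_run (M b) w (Suc n))),
       layout b ((settle ^^ n) t0) (map emb (snd (tm_run (M b) w (Suc n)))) (map (settle ^^ n) S))"
  using assms(3)
proof (induction n)
  case (Suc n)
  obtain q T where C: "tm_run (M b) w (Suc n) = (Run q, T)"
    using Suc.prems[of n] by (metis lessI prod.collapse)
  have v: "valid_config (M b) (Run q, T)"
    using valid_config_run[OF wf_M assms(1), of "Suc n"] C by simp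
  have C': "tm_run (M b) w (Suc (Suc n)) = tm_step (M b) (Run q, T)"
    using C by (simp add: tm_run_def)
  have "(tm_step machine ^^ n)
      (lift b (fst (tm_run (M b) w 1)), layout b t0 (map emb (snd (tm_run (M b) w 1))) S)
    = (lift b (Run q), layout b ((settle ^^ n) t0) (map emb T) (map (settle ^^ n) S))"
    using Suc.IH Suc.prems by (simp add: C)
  thus ?case
    using step_sim[OF v, of "map (settle ^^ n) S"] assms(2)
    by (simp add: C' o_def del: lift.simps tm_step.simps)
qed simp

lemma steps_machine:
  assumes "tm_decides (M b) (Y b) L" "u \<in> lists (Y b)" "length S = k (\<not> b)"
  obtains T where "length T = k b"
    "(tm_step machine ^^ (length u + tm_time (M b) u + 1)) (Run (to_nat (Rewind b)), layout b t0 (parked b u) S)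
      = (lift b (if u \<in> L then Yes else No),
         layout b ((settle ^^ (length u + tm_time (M b) u + 1)) t0) T
           (map (settle ^^ (length u + tm_time (M b) u + 1)) S))"
proof -
  let ?t = "tm_time (M b) u" and ?j = "Suc (length u)"
  note dt = tm_decides_time[OF assms(1,2)]
  \<comment> \<open>From right to left: \<open>Suc (length u)\<close> steps of rewinding from the
    blank after \<open>u\<close>, one step that leaves \<open>Rewind\<close>, and the remaining
    \<open>?t - 1\<close> steps of \<open>M b\<close>.\<close>
  have n: "length u + ?t + 1 = (?t - 1) + (Suc 0 + ?j)" using dt(3) by simp
  have t: "Suc (?t - 1) = ?t" using dt(3) by simp
  have p: "parked b u = rewinding b u ?j" by (simp add: parked_def rewinding_def)
  have s: "(settle ^^ (length u + ?t + 1)) x = (settle ^^ (?t - 1)) (settle ((settle ^^ ?j) x))" for x :: "'a tape"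
    unfolding n funpow_add o_apply by simp
  have sim: "(tm_step machine ^^ (?t - 1))
      (lift b (fst (tm_run (M b) u 1)), layout b x (map emb (snd (tm_run (M b) u 1))) S')
    = (lift b (fst (tm_run (M b) u ?t)),
       layout b ((settle ^^ (?t - 1)) x) (map emb (snd (tm_run (M b) u ?t))) (map (settle ^^ (?t - 1)) S'))"
    if "length S' = k (\<not> b)" for x S'
    using steps_sim[OF assms(2) that, of "?t - 1"] dt(2) unfolding t by simp
  have f1: "(tm_step machine ^^ Suc 0) C = tm_step machine C" for C
    by simp
  have "(tm_step machine ^^ (length u + ?t + 1)) (Run (to_nat (Rewind b)), layout b t0 (parked b u) S)
    = (lift b (if u \<in> L then Yes else No),
       layout b ((settle ^^ (length u + ?t + 1)) t0) (map emb (snd (tm_run (M b) u ?t)))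
         (map (settle ^^ (length u + ?t + 1)) S))"
    unfolding s unfolding n p funpow_add o_apply steps_rewind[OF assms(3)]
    using assms(3) f1 by (simp add: step_start[unfolded One_nat_def] sim[unfolded One_nat_def] dt(1) o_def del: funpow.simps(2) tm_step.simps lift.simps)
  moreover have "length (map emb (snd (tm_run (M b) u ?t))) = k b"
    using valid_config_run[OF wf_M assms(2)] by (simp add: valid_config_def)
  ultimately show thesis using that by blast
qed

text \<open>
  Each of the two output words, of length at most \<open>B * length w\<close>, is written once and rewound at most
  once, which makes \<open>4 * B * length w\<close> steps.
\<close>

theorem machine_time:
  assumes L: "\<And>b. tm_decides (M b) (Y b) (L b)"
  assumes w: "w \<in> lists X"
  defines "passes \<equiv> drive q0 w \<in> Fin \<and> emit False q0 w \<in> L False"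
  obtains n where
    "fst (tm_run machine w n) = (if passes \<and> emit True q0 w \<in> L True then Yes else No)"
    "n \<le> (4 * B + 1) * length w + 4 + tm_time (M False) (emit False q0 w)
          + (if passes then tm_time (M True) (emit True q0 w) else 0)"
proof -
  let ?p = "emit False q0 w" and ?p' = "emit True q0 w" and ?c = "drive q0 w"
  let ?step = "tm_step machine"
  let ?s = "scan_time q0 w" and ?t = "length ?p + tm_time (M False) ?p + 1"
    and ?t' = "length ?p' + tm_time (M True) ?p' + 1"
  have p: "?p \<in> lists (Y False)" "?p' \<in> lists (Y True)" using emit_in[OF q0 w] by auto
  have len: "length ?p \<le> B * length w" "length ?p' \<le> B * length w"
    using emit_length[OF q0 w] by auto
  have s: "?s \<le> length w + 2 * (B * length w)" using len by (simp add: scan_time_def)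
  \<comment> \<open>One step to leave cell 0, the scan, and one step on the blank after the input.
    These two extra steps and the extra step of each of the two machine phases add up to the
    constant 4.\<close>
  have scan: "(?step ^^ (1 + Suc ?s)) (init_config machine w) =
      (if ?c \<in> Fin then Run (to_nat (Rewind False)) else No,
       layout False (scanned w (length w)) (parked False ?p) (parked True ?p'))"
    using step_scan_end[of ?c w ?p ?p'] steps_to_scan[of w]
    unfolding funpow_add o_apply by (simp del: funpow.simps(2) tm_step.simps) simp
  have r: "read (scanned w (length w)) \<noteq> Start" by (simp add: scanned_read)
  show thesis
  proof (cases "?c \<in> Fin")
    case False
    have "fst (tm_run machine w (1 + Suc ?s)) = No"
      unfolding tm_run_def scan using False by simp
    moreover have "1 + Suc ?s \<le> (4 * B + 1) * length w + 4 + tm_time (M False) ?p"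
      using s by (simp add: algebra_simps)
    ultimately show thesis using that[of "1 + Suc ?s"] False by (simp add: passes_def)
  next
    case True
    obtain T where T: "length T = k False"
      "(?step ^^ ?t) (Run (to_nat (Rewind False)),
          layout False (scanned w (length w)) (parked False ?p) (parked True ?p'))
      = (lift False (if ?p \<in> L False then Yes else No),
         layout False ((settle ^^ ?t) (scanned w (length w))) T (map (settle ^^ ?t) (parked True ?p')))"
      using steps_machine[OF L[of False] p(1)] by (metis length_parked)
    have sp: "map (settle ^^ ?t) (parked True ?p') = parked True ?p'"
      by (intro map_settle_funpow_id) (auto dest: parked_read)
    have first: "tm_run machine w (?t + (1 + Suc ?s)) =
      (lift False (if ?p \<in> L False then Yes else No),
         layout False (scanned w (length w)) T (parked True ?p'))"
      unfolding tm_run_def funpow_add[of ?t] o_apply scan using True T(2)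
      by (simp only: if_True sp settle_funpow_id[OF r])
    show thesis
    proof (cases "?p \<in> L False")
      case False
      have "fst (tm_run machine w (?t + (1 + Suc ?s))) = No" unfolding first using False by simp
      moreover have "?t + (1 + Suc ?s) \<le> (4 * B + 1) * length w + 4 + tm_time (M False) ?p"
        using s len by (simp add: algebra_simps)
      ultimately show thesis using that[of "?t + (1 + Suc ?s)"] False by (simp add: passes_def)
    next
      case pass: True
      obtain T' where T':
        "(?step ^^ ?t') (Run (to_nat (Rewind True)),
            layout True (scanned w (length w)) (parked True ?p') T)
        = (lift True (if ?p' \<in> L True then Yes else No),
           layout True ((settle ^^ ?t') (scanned w (length w))) T' (map (settle ^^ ?t') T))"
      proof (rule steps_machine[OF L[of True] p(2), of T "scanned w (length w)"])
        show "length T = k (\<not> True)" using T(1) by simp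
      qed
      have "fst (tm_run machine w (?t' + (?t + (1 + Suc ?s)))) = (if ?p' \<in> L True then Yes else No)"
        using first pass T' unfolding tm_run_def funpow_add[of ?t'] o_apply
        by (simp add: layout_swap[of False] del: funpow.simps tm_step.simps)
      moreover have "?t' + (?t + (1 + Suc ?s))
          \<le> (4 * B + 1) * length w + 4 + tm_time (M False) ?p + tm_time (M True) ?p'"
        using s len by (simp add: algebra_simps)
      ultimately show thesis using that[of "?t' + (?t + (1 + Suc ?s))"] pass True
        by (simp add: passes_def)
    qed
  qed
qed

end

section \<open>Invariant means and the spectral gap\<close>

definition mean_on :: "'w set \<Rightarrow> ('w set \<Rightarrow> real) \<Rightarrow> bool" where
  "mean_on \<Omega> m \<longleftrightarrow> m \<Omega> = 1 \<and> (\<forall>S\<subseteq>\<Omega>. 0 \<le> m S) \<and>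
     (\<forall>S\<subseteq>\<Omega>. \<forall>T\<subseteq>\<Omega>. S \<inter> T = {} \<longrightarrow> m (S \<union> T) = m S + m T)"

text \<open>Tychonoff's theorem for the topology of pointwise convergence; the index type will be
  the type of subsets.\<close>

lemma compact_unit_cube: "compact {m :: 'i \<Rightarrow> real. \<forall>i. m i \<in> {0..1}}"
proof -
  have "compactin (product_topology (\<lambda>i::'i. euclidean :: real topology) UNIV) (PiE UNIV (\<lambda>i. {0..1}))"
    by (subst compactin_PiE) auto
  moreover have "PiE UNIV (\<lambda>i. {0..1}) = {m :: 'i \<Rightarrow> real. \<forall>i. m i \<in> {0..1}}"
    by (auto simp: PiE_def)
  ultimately show ?thesis
    by (simp add: euclidean_product_topology compactin_euclidean_iff)
qed

text \<open>Means form a compact set, so approximate equations between their values can be made exact.\<close>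

lemma mean_on_compactness:
  fixes R :: "('w set \<times> 'w set) set"
  assumes approx: "\<And>\<delta>. \<delta> > 0 \<Longrightarrow> \<exists>m. mean_on \<Omega> m \<and> (\<forall>(A, B)\<in>R. \<bar>m A - m B\<bar> \<le> \<delta>)"
    and R: "R \<subseteq> Pow \<Omega> \<times> Pow \<Omega>"
  shows "\<exists>m. mean_on \<Omega> m \<and> (\<forall>(A, B)\<in>R. m A = m B)"
proof -
  define C where "C = {m :: 'w set \<Rightarrow> real. \<forall>A. m A \<in> {0..1}}"
  \<comment> \<open>Every condition involves finitely many values of \<open>m\<close>, so it is
    closed under pointwise convergence. The sets \<open>K k\<close> decrease, hence one approximate
    mean for the largest index lies in finitely many of them.\<close>
  define K where "K k = {m :: 'w set \<Rightarrow> real. m \<Omega> = 1} \<inter>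
     (\<Inter>S\<in>Pow \<Omega>. {m. 0 \<le> m S}) \<inter>
     (\<Inter>(S, T)\<in>{(S, T). S \<subseteq> \<Omega> \<and> T \<subseteq> \<Omega> \<and> S \<inter> T = {}}. {m. m (S \<union> T) = m S + m T}) \<inter>
     (\<Inter>(A, B)\<in>R. {m. \<bar>m A - m B\<bar> \<le> 1 / Suc k})" for k :: nat
  have K_iff: "m \<in> K k \<longleftrightarrow> mean_on \<Omega> m \<and> (\<forall>(A, B)\<in>R. \<bar>m A - m B\<bar> \<le> 1 / Suc k)" for m k
    by (auto simp: K_def mean_on_def)
  have closed: "closed (K k)" for k
    unfolding K_def by (intro closed_Int closed_INT ballI)
       (auto intro!: closed_Collect_eq closed_Collect_le continuous_intros
          continuous_on_product_coordinates)
  have compact_C: "compact C" unfolding C_def by (rule compact_unit_cube)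
  have "C \<inter> (\<Inter>k\<in>UNIV. K k) \<noteq> {}"
  proof (rule compact_imp_fip_image[OF compact_C closed])
    fix I :: "nat set" assume I: "finite I"
    obtain N where N: "\<forall>k\<in>I. k \<le> N" using I by (meson finite_nat_set_iff_bounded_le)
    obtain m where m: "mean_on \<Omega> m" "\<forall>(A, B)\<in>R. \<bar>m A - m B\<bar> \<le> 1 / Suc N"
      using approx[of "1 / Suc N"] by auto
    \<comment> \<open>\<open>mean_on\<close> says nothing about sets that are not contained in
      \<Omega>; their values must be brought into the unit interval for the mean to lie in the
      cube.\<close>
    define m' where "m' A = m (A \<inter> \<Omega>)" for A
    have m': "m' A = m A" if "A \<subseteq> \<Omega>" for A using that by (simp add: m'_def Int_absorb2)
    have mean: "mean_on \<Omega> m'"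
      using m(1) unfolding mean_on_def by (simp add: m')
    have le1: "m A \<le> 1" if "A \<subseteq> \<Omega>" for A
    proof -
      have "m (A \<union> (\<Omega> - A)) = m A + m (\<Omega> - A)"
        using m(1) that unfolding mean_on_def by (metis Diff_disjoint Diff_subset)
      moreover have "m (\<Omega> - A) \<ge> 0" using m(1) unfolding mean_on_def by blast
      moreover have "A \<union> (\<Omega> - A) = \<Omega>" using that by auto
      moreover have "m \<Omega> = 1" using m(1) unfolding mean_on_def by blast
      ultimately show ?thesis by (metis le_add_same_cancel1)
    qed
    have "m' \<in> C"
      using m(1) le1 by (auto simp: C_def m'_def mean_on_def)
    moreover have "m' \<in> K k" if k: "k \<in> I" for k
      unfolding K_iff
    proof (intro conjI mean ballI, clarify)
      fix A B assume AB: "(A, B) \<in> R"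
      hence "\<bar>m A - m B\<bar> \<le> 1 / Suc N" using m(2) by auto
      also have "\<dots> \<le> 1 / Suc k" using N k by (auto intro!: divide_left_mono)
      finally show "\<bar>m' A - m' B\<bar> \<le> 1 / Suc k" using AB R by (auto simp: m')
    qed
    ultimately show "C \<inter> (\<Inter>k\<in>I. K k) \<noteq> {}" by blast
  qed
  then obtain m where m: "\<And>k. m \<in> K k" by blast
  have "m A = m B" if AB: "(A, B) \<in> R" for A B
  proof (rule ccontr)
    assume "m A \<noteq> m B"
    then obtain k where "inverse (Suc k) < \<bar>m A - m B\<bar>"
      using reals_Archimedean[of "\<bar>m A - m B\<bar>"] by auto
    moreover have "\<bar>m A - m B\<bar> \<le> 1 / Suc k" using m[of k] AB unfolding K_iff by auto
    ultimately show False by (simp add: inverse_eq_divide)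
  qed
  thus ?thesis using m unfolding K_iff by blast
qed

section \<open>Almost invariant means and the spectral gap\<close>

locale symmetric_action =
  fixes \<Omega> :: "'w set" and X :: "'x set" and \<sigma> :: "'x \<Rightarrow> 'w \<Rightarrow> 'w" and \<iota> :: "'x \<Rightarrow> 'x"
  assumes finite_X: "finite X" and X_nonempty: "X \<noteq> {}"
    and \<sigma>_in: "x \<in> X \<Longrightarrow> \<omega> \<in> \<Omega> \<Longrightarrow> \<sigma> x \<omega> \<in> \<Omega>"
    and \<iota>_in: "x \<in> X \<Longrightarrow> \<iota> x \<in> X"
    and \<iota>_\<iota>: "x \<in> X \<Longrightarrow> \<iota> (\<iota> x) = x"
    and \<sigma>_\<iota>: "x \<in> X \<Longrightarrow> \<omega> \<in> \<Omega> \<Longrightarrow> \<sigma> (\<iota> x) (\<sigma> x \<omega>) = \<omega>"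
begin

abbreviation d :: real where "d \<equiv> real (card X)"

lemma d_pos: "d > 0"
  using finite_X X_nonempty by (simp add: card_gt_0_iff)

lemma \<sigma>_inj: "x \<in> X \<Longrightarrow> inj_on (\<sigma> x) \<Omega>"
  by (rule inj_on_inverseI[of _ "\<sigma> (\<iota> x)"]) (simp add: \<sigma>_\<iota>)

lemma \<sigma>_\<iota>': "x \<in> X \<Longrightarrow> \<omega> \<in> \<Omega> \<Longrightarrow> \<sigma> x (\<sigma> (\<iota> x) \<omega>) = \<omega>"
  using \<sigma>_\<iota>[of "\<iota> x" \<omega>] by (simp add: \<iota>_in \<iota>_\<iota>)

lemma \<sigma>_image: "x \<in> X \<Longrightarrow> \<sigma> x ` \<Omega> = \<Omega>"
  using \<sigma>_in \<sigma>_\<iota>' \<iota>_in by (metis image_subsetI subsetI subset_antisym image_eqI)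

lemma \<iota>_bij: "bij_betw \<iota> X X"
  by (rule bij_betw_byWitness[of _ \<iota>]) (auto simp: \<iota>_in \<iota>_\<iota>)

text \<open>The factor \<open>d\<^sup>2\<close> stems from summing over the letters instead of averaging.\<close>

definition spectral_gap :: "real \<Rightarrow> bool" where
  "spectral_gap \<epsilon> \<longleftrightarrow> (\<forall>f :: 'w \<Rightarrow> real. \<forall>S B. finite S \<and> S \<subseteq> \<Omega> \<and> (\<forall>\<omega>\<in>\<Omega> - S. f \<omega> = 0) \<and> finite B \<and> B \<subseteq> \<Omega> \<longrightarrow>
     (\<Sum>\<omega>\<in>B. (\<Sum>x\<in>X. f (\<sigma> x \<omega>))\<^sup>2) \<le> (1 - \<epsilon>) * d\<^sup>2 * (\<Sum>\<omega>\<in>S. (f \<omega>)\<^sup>2))"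

text \<open>
  For \<open>m A\<close> proportional to the sum of \<open>f\<^sup>2\<close> over \<open>A\<close>, use that the sum over all letters \<open>x\<close>, \<open>y\<close>
  of the squared norm of \<open>f \<circ> \<sigma> x - f \<circ> \<sigma> y\<close> is \<open>2 * d\<^sup>2\<close> times the loss of squared norm under averaging.
\<close>

lemma almost_invariant_mean:
  assumes "\<not> spectral_gap \<epsilon>" "0 < \<epsilon>"
  obtains m where "mean_on \<Omega> m"
    "\<And>x y A. \<lbrakk>x \<in> X; y \<in> X; A \<subseteq> \<Omega>\<rbrakk> \<Longrightarrow> (m (\<sigma> x ` A) - m (\<sigma> y ` A))\<^sup>2 \<le> 8 * d\<^sup>2 * \<epsilon>"
proof -
  from assms obtain f :: "'w \<Rightarrow> real" and S B0 where S: "finite S" "S \<subseteq> \<Omega>" and f0: "\<And>\<omega>. \<omega> \<in> \<Omega> - S \<Longrightarrow> f \<omega> = 0"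
    and B0: "finite B0" "B0 \<subseteq> \<Omega>"
    and big: "(\<Sum>\<omega>\<in>B0. (\<Sum>x\<in>X. f (\<sigma> x \<omega>))\<^sup>2) > (1 - \<epsilon>) * d\<^sup>2 * (\<Sum>\<omega>\<in>S. (f \<omega>)\<^sup>2)"
    unfolding spectral_gap_def not_all not_imp not_le by blast
  define Z where "Z = (\<Sum>\<omega>\<in>S. (f \<omega>)\<^sup>2)"
  \<comment> \<open>Outside \<open>B\<close> all functions \<open>f \<circ> \<sigma> x\<close>
    vanish, as \<sigma> (\<iota> x) \<open>S\<close> consists of the points that \<sigma> x sends
    into \<open>S\<close>. So sums over \<open>B\<close> are full inner products, and adding
    \<open>B0\<close> keeps the violated inequality.\<close>
  define B where "B = B0 \<union> (\<Union>x\<in>X. \<sigma> (\<iota> x) ` S)"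
  have B: "finite B" "B \<subseteq> \<Omega>" using B0 S finite_X \<sigma>_in \<iota>_in by (auto simp: B_def)
  have Z: "Z > 0"
  proof (rule ccontr)
    assume "\<not> Z > 0"
    moreover have "Z \<ge> 0" unfolding Z_def by (intro sum_nonneg) auto
    ultimately have Z0: "Z = 0" by simp
    hence "f \<omega> = 0" if "\<omega> \<in> S" for \<omega>
      using S that unfolding Z_def by (subst (asm) sum_nonneg_eq_0_iff) auto
    hence "f \<omega> = 0" if "\<omega> \<in> \<Omega>" for \<omega> using f0 that by auto
    hence "(\<Sum>\<omega>\<in>B0. (\<Sum>x\<in>X. f (\<sigma> x \<omega>))\<^sup>2) = 0"
      using B0 \<sigma>_in by (intro sum.neutral) (auto simp: subset_iff)
    thus False using big Z0 by (simp add: Z_def)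
  qed
  have shift: "(\<Sum>\<omega>\<in>A \<inter> B. (f (\<sigma> x \<omega>))\<^sup>2) = (\<Sum>\<omega>\<in>\<sigma> x ` A \<inter> S. (f \<omega>)\<^sup>2)"
    if x: "x \<in> X" and A: "A \<subseteq> \<Omega>" for x A
  proof -
    have "(\<Sum>\<omega>\<in>A \<inter> B. (f (\<sigma> x \<omega>))\<^sup>2) = (\<Sum>\<omega>\<in>\<sigma> x ` (A \<inter> B). (f \<omega>)\<^sup>2)"
      using inj_on_subset[OF \<sigma>_inj[OF x], of "A \<inter> B"] A by (subst sum.reindex) auto
    also have "\<dots> = (\<Sum>\<omega>\<in>\<sigma> x ` A \<inter> S. (f \<omega>)\<^sup>2)"
    proof (rule sum.mono_neutral_right)
      show "\<sigma> x ` A \<inter> S \<subseteq> \<sigma> x ` (A \<inter> B)"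
      proof
        fix \<omega> assume "\<omega> \<in> \<sigma> x ` A \<inter> S"
        then obtain a where a: "a \<in> A" "\<omega> = \<sigma> x a" "\<omega> \<in> S" by auto
        hence "a = \<sigma> (\<iota> x) \<omega>" using \<sigma>_\<iota> x A by auto
        hence "a \<in> B" using a x by (auto simp: B_def)
        thus "\<omega> \<in> \<sigma> x ` (A \<inter> B)" using a by auto
      qed
      show "\<forall>\<omega>\<in>\<sigma> x ` (A \<inter> B) - \<sigma> x ` A \<inter> S. (f \<omega>)\<^sup>2 = 0"
      proof
        fix \<omega> assume "\<omega> \<in> \<sigma> x ` (A \<inter> B) - \<sigma> x ` A \<inter> S"
        hence "\<omega> \<in> \<Omega> - S" using A x \<sigma>_in by auto
        thus "(f \<omega>)\<^sup>2 = 0" using f0 by simp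
      qed
    qed (use B in simp)
    finally show ?thesis .
  qed
  have norm: "(\<Sum>\<omega>\<in>B. (f (\<sigma> x \<omega>))\<^sup>2) = Z" if "x \<in> X" for x
    using shift[OF that order.refl] B S by (simp add: \<sigma>_image that Int_absorb1 Z_def)
  define m where "m A = (\<Sum>\<omega>\<in>A \<inter> S. (f \<omega>)\<^sup>2) / Z" for A
  have mean: "mean_on \<Omega> m"
    unfolding mean_on_def
  proof (intro conjI allI impI)
    show "m \<Omega> = 1" using Z S by (simp add: m_def Z_def Int_absorb1)
    show "0 \<le> m A" for A using Z by (auto simp: m_def intro!: sum_nonneg divide_nonneg_pos)
    show "m (A \<union> C) = m A + m C" if "A \<inter> C = {}" for A C
    proof -
      have "(A \<union> C) \<inter> S = (A \<inter> S) \<union> (C \<inter> S)" by auto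
      thus ?thesis using that S
        by (simp add: m_def add_divide_distrib[symmetric]) (subst sum.union_disjoint; auto)
    qed
  qed
  have "(m (\<sigma> x ` A) - m (\<sigma> y ` A))\<^sup>2 \<le> 8 * d\<^sup>2 * \<epsilon>" if x: "x \<in> X" and y: "y \<in> X" and A: "A \<subseteq> \<Omega>" for x y A
  proof -
    \<comment> \<open>A difference of squares factors as \<open>?u * ?v\<close>, which calls for
      Cauchy-Schwarz. The squared norm of \<open>?u\<close> is at most
      \<open>2 * d\<^sup>2 * \<epsilon> * Z\<close> and that of \<open>?v\<close> at most
      \<open>4 * Z\<close>; their product gives the constant 8.\<close>
    let ?u = "\<lambda>\<omega>. f (\<sigma> x \<omega>) - f (\<sigma> y \<omega>)" and ?v = "\<lambda>\<omega>. f (\<sigma> x \<omega>) + f (\<sigma> y \<omega>)"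
    have "Z * (m (\<sigma> x ` A) - m (\<sigma> y ` A)) = (\<Sum>\<omega>\<in>A \<inter> B. ?u \<omega> * ?v \<omega>)"
      using Z shift[OF x A] shift[OF y A]
      by (simp add: m_def right_diff_distrib sum_subtractf power2_eq_square algebra_simps)
    hence "\<bar>Z * (m (\<sigma> x ` A) - m (\<sigma> y ` A))\<bar> \<le> (\<Sum>\<omega>\<in>A \<inter> B. \<bar>?u \<omega>\<bar> * \<bar>?v \<omega>\<bar>)"
      by (simp flip: abs_mult)
    also have "\<dots> \<le> (\<Sum>\<omega>\<in>B. \<bar>?u \<omega>\<bar> * \<bar>?v \<omega>\<bar>)"
      using B by (intro sum_mono2) auto
    also have "\<dots> \<le> L2_set ?u B * L2_set ?v B"
      by (rule L2_set_mult_ineq)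
    finally have "\<bar>Z * (m (\<sigma> x ` A) - m (\<sigma> y ` A))\<bar>\<^sup>2 \<le> (L2_set ?u B * L2_set ?v B)\<^sup>2"
      by (intro power_mono) auto
    hence 1: "Z\<^sup>2 * (m (\<sigma> x ` A) - m (\<sigma> y ` A))\<^sup>2 \<le> (\<Sum>\<omega>\<in>B. (?u \<omega>)\<^sup>2) * (\<Sum>\<omega>\<in>B. (?v \<omega>)\<^sup>2)"
      by (simp add: power_mult_distrib L2_set_def sum_nonneg)
    have "(\<Sum>\<omega>\<in>B. (?v \<omega>)\<^sup>2) \<le> (\<Sum>\<omega>\<in>B. 2 * (f (\<sigma> x \<omega>))\<^sup>2 + 2 * (f (\<sigma> y \<omega>))\<^sup>2)"
    proof (rule sum_mono)
      fix \<omega>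
      have "0 \<le> (?u \<omega>)\<^sup>2" by simp
      thus "(?v \<omega>)\<^sup>2 \<le> 2 * (f (\<sigma> x \<omega>))\<^sup>2 + 2 * (f (\<sigma> y \<omega>))\<^sup>2"
        by (simp add: power2_eq_square algebra_simps)
    qed
    also have "\<dots> = 4 * Z" using norm[OF x] norm[OF y] by (simp add: sum.distrib sum_distrib_left[symmetric])
    finally have 2: "(\<Sum>\<omega>\<in>B. (?v \<omega>)\<^sup>2) \<le> 4 * Z" .
    have "(\<Sum>\<omega>\<in>B. (?u \<omega>)\<^sup>2) \<le> (\<Sum>p\<in>X \<times> X. \<Sum>\<omega>\<in>B. (f (\<sigma> (fst p) \<omega>) - f (\<sigma> (snd p) \<omega>))\<^sup>2)"
      using member_le_sum[of "(x, y)" "X \<times> X" "\<lambda>p. \<Sum>\<omega>\<in>B. (f (\<sigma> (fst p) \<omega>) - f (\<sigma> (snd p) \<omega>))\<^sup>2"]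
        x y finite_X by (simp add: sum_nonneg)
    also have "\<dots> = (\<Sum>x\<in>X. \<Sum>y\<in>X. \<Sum>\<omega>\<in>B. (f (\<sigma> x \<omega>) - f (\<sigma> y \<omega>))\<^sup>2)"
      by (simp only: sum.cartesian_product[of "\<lambda>x y. \<Sum>\<omega>\<in>B. (f (\<sigma> x \<omega>) - f (\<sigma> y \<omega>))\<^sup>2" X X]
          case_prod_unfold)
    also have "\<dots> = (\<Sum>x\<in>X. \<Sum>y\<in>X. 2 * Z - 2 * (\<Sum>\<omega>\<in>B. f (\<sigma> x \<omega>) * f (\<sigma> y \<omega>)))"
    proof (intro sum.cong HOL.refl)
      fix x y assume "x \<in> X" "y \<in> X"
      have "(\<Sum>\<omega>\<in>B. (f (\<sigma> x \<omega>) - f (\<sigma> y \<omega>))\<^sup>2)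
          = (\<Sum>\<omega>\<in>B. (f (\<sigma> x \<omega>))\<^sup>2 + (f (\<sigma> y \<omega>))\<^sup>2 - 2 * (f (\<sigma> x \<omega>) * f (\<sigma> y \<omega>)))"
        by (rule sum.cong[OF HOL.refl]) (simp add: power2_diff mult.assoc)
      thus "(\<Sum>\<omega>\<in>B. (f (\<sigma> x \<omega>) - f (\<sigma> y \<omega>))\<^sup>2) = 2 * Z - 2 * (\<Sum>\<omega>\<in>B. f (\<sigma> x \<omega>) * f (\<sigma> y \<omega>))"
        using norm \<open>x \<in> X\<close> \<open>y \<in> X\<close> by (simp add: sum.distrib sum_subtractf sum_distrib_left[symmetric])
    qed
    also have "\<dots> = 2 * d\<^sup>2 * Z - 2 * (\<Sum>x\<in>X. \<Sum>y\<in>X. \<Sum>\<omega>\<in>B. f (\<sigma> x \<omega>) * f (\<sigma> y \<omega>))"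
      by (simp add: sum_subtractf sum_distrib_left[symmetric] power2_eq_square)
    also have "(\<Sum>x\<in>X. \<Sum>y\<in>X. \<Sum>\<omega>\<in>B. f (\<sigma> x \<omega>) * f (\<sigma> y \<omega>))
        = (\<Sum>\<omega>\<in>B. (\<Sum>x\<in>X. f (\<sigma> x \<omega>))\<^sup>2)"
    proof -
      have "(\<Sum>x\<in>X. \<Sum>y\<in>X. \<Sum>\<omega>\<in>B. f (\<sigma> x \<omega>) * f (\<sigma> y \<omega>))
         = (\<Sum>x\<in>X. \<Sum>\<omega>\<in>B. \<Sum>y\<in>X. f (\<sigma> x \<omega>) * f (\<sigma> y \<omega>))"
        by (intro sum.cong HOL.refl sum.swap)
      also have "\<dots> = (\<Sum>\<omega>\<in>B. \<Sum>x\<in>X. \<Sum>y\<in>X. f (\<sigma> x \<omega>) * f (\<sigma> y \<omega>))" by (rule sum.swap)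
      finally show ?thesis by (simp add: power2_eq_square sum_product)
    qed
    also have "2 * d\<^sup>2 * Z - 2 * (\<Sum>\<omega>\<in>B. (\<Sum>x\<in>X. f (\<sigma> x \<omega>))\<^sup>2) \<le> 2 * d\<^sup>2 * Z - 2 * ((1 - \<epsilon>) * d\<^sup>2 * Z)"
    proof -
      have "(\<Sum>\<omega>\<in>B0. (\<Sum>x\<in>X. f (\<sigma> x \<omega>))\<^sup>2) \<le> (\<Sum>\<omega>\<in>B. (\<Sum>x\<in>X. f (\<sigma> x \<omega>))\<^sup>2)"
        using B by (intro sum_mono2) (auto simp: B_def)
      thus ?thesis using big unfolding Z_def by linarith
    qed
    also have "\<dots> = 2 * d\<^sup>2 * \<epsilon> * Z" by (simp add: algebra_simps)
    finally have 3: "(\<Sum>\<omega>\<in>B. (?u \<omega>)\<^sup>2) \<le> 2 * d\<^sup>2 * \<epsilon> * Z" .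
    have "(\<Sum>\<omega>\<in>B. (?u \<omega>)\<^sup>2) * (\<Sum>\<omega>\<in>B. (?v \<omega>)\<^sup>2) \<le> (2 * d\<^sup>2 * \<epsilon> * Z) * (4 * Z)"
      using 2 3 Z assms(2) by (intro mult_mono) (auto intro!: sum_nonneg)
    hence "Z\<^sup>2 * (m (\<sigma> x ` A) - m (\<sigma> y ` A))\<^sup>2 \<le> Z\<^sup>2 * (8 * d\<^sup>2 * \<epsilon>)"
      using 1 by (simp add: power2_eq_square algebra_simps)
    thus ?thesis using Z by simp
  qed
  thus thesis using mean that by blast
qed

text \<open>
  The limit of the almost invariant means only satisfies \<open>m (\<sigma> x ` A) = m (\<sigma> y ` A)\<close>, which is
  invariance under words of even length; averaging \<open>m\<close> with its translate by one letter repairs this.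
\<close>

lemma invariant_mean:
  assumes no_gap: "\<And>\<epsilon>. 0 < \<epsilon> \<Longrightarrow> \<not> spectral_gap \<epsilon>"
  shows "\<exists>m. mean_on \<Omega> m \<and> (\<forall>x\<in>X. \<forall>A\<subseteq>\<Omega>. m (\<sigma> x ` A) = m A)"
proof -
  let ?R = "{(\<sigma> x ` A, \<sigma> y ` A) | x y A. x \<in> X \<and> y \<in> X \<and> A \<subseteq> \<Omega>}"
  have sub: "\<sigma> x ` A \<subseteq> \<Omega>" if "x \<in> X" "A \<subseteq> \<Omega>" for x A using that \<sigma>_in by auto
  have "\<exists>m. mean_on \<Omega> m \<and> (\<forall>(A, B)\<in>?R. m A = m B)"
  proof (rule mean_on_compactness)
    fix \<delta> :: real assume \<delta>: "\<delta> > 0"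
    define \<epsilon> where "\<epsilon> = \<delta>\<^sup>2 / (8 * d\<^sup>2)"
    have \<epsilon>: "\<epsilon> > 0" "8 * d\<^sup>2 * \<epsilon> = \<delta>\<^sup>2" using \<delta> d_pos X_nonempty finite_X by (auto simp: \<epsilon>_def)
    obtain m where m: "mean_on \<Omega> m"
      "\<And>x y A. \<lbrakk>x \<in> X; y \<in> X; A \<subseteq> \<Omega>\<rbrakk> \<Longrightarrow> (m (\<sigma> x ` A) - m (\<sigma> y ` A))\<^sup>2 \<le> \<delta>\<^sup>2"
      using almost_invariant_mean[OF no_gap[OF \<epsilon>(1)] \<epsilon>(1)] unfolding \<epsilon>(2) by blast
    have "\<bar>m (\<sigma> x ` A) - m (\<sigma> y ` A)\<bar> \<le> \<delta>" if "x \<in> X" "y \<in> X" "A \<subseteq> \<Omega>" for x y A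
      using m(2)[OF that] \<delta> by (simp add: abs_le_square_iff[symmetric])
    thus "\<exists>m. mean_on \<Omega> m \<and> (\<forall>(A, B)\<in>?R. \<bar>m A - m B\<bar> \<le> \<delta>)"
      using m(1) by (intro exI[of _ m]) auto
  next
    show "?R \<subseteq> Pow \<Omega> \<times> Pow \<Omega>" using sub by (auto simp: image_subset_iff)
  qed
  then obtain m where mean: "mean_on \<Omega> m" and mR: "\<forall>(A, B)\<in>?R. m A = m B" by auto
  have m: "m (\<sigma> x ` A) = m (\<sigma> y ` A)" if "x \<in> X" "y \<in> X" "A \<subseteq> \<Omega>" for x y A
    using that by (intro bspec[OF mR, of "(\<sigma> x ` A, \<sigma> y ` A)", simplified]) auto
  obtain x0 where x0: "x0 \<in> X" using X_nonempty by auto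
  define m' where "m' A = (m A + m (\<sigma> x0 ` A)) / 2" for A
  have inter: "\<sigma> x0 ` S \<inter> \<sigma> x0 ` T = {}" if "S \<subseteq> \<Omega>" "T \<subseteq> \<Omega>" "S \<inter> T = {}" for S T
    using inj_on_image_Int[OF \<sigma>_inj[OF x0] that(1,2)] that(3) by simp
  have "mean_on \<Omega> m'"
    using mean sub[OF x0] inter unfolding mean_on_def m'_def
    by (simp add: \<sigma>_image[OF x0] image_Un field_simps)
  moreover have "m' (\<sigma> y ` A) = m' A" if y: "y \<in> X" and A: "A \<subseteq> \<Omega>" for y A
  proof -
    \<comment> \<open>Translation by \<open>y\<close> exchanges the two halves of \<open>m'\<close>:
      any letter may replace \<open>x0\<close> in front of \<sigma> y, and \<iota> y cancels it,
      while on \<open>A\<close> itself \<open>y\<close> may be replaced by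
      \<open>x0\<close>.\<close>
    have "m (\<sigma> x0 ` \<sigma> y ` A) = m (\<sigma> (\<iota> y) ` \<sigma> y ` A)"
      using m[OF x0 \<iota>_in[OF y] sub[OF y A]] .
    also have "\<sigma> (\<iota> y) ` \<sigma> y ` A = A"
      using A y by (force simp: image_image \<sigma>_\<iota> subset_iff)
    finally show ?thesis using m[OF x0 y A] by (simp add: m'_def)
  qed
  ultimately show ?thesis by blast
qed

section \<open>Counting closed paths\<close>

fun act :: "'x list \<Rightarrow> 'w \<Rightarrow> 'w" where
  "act [] \<omega> = \<omega>"
| "act (x # w) \<omega> = \<sigma> x (act w \<omega>)"

lemma act_in: "w \<in> lists X \<Longrightarrow> \<omega> \<in> \<Omega> \<Longrightarrow> act w \<omega> \<in> \<Omega>"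
  by (induction w) (auto simp: \<sigma>_in)

definition paths :: "'w \<Rightarrow> nat \<Rightarrow> 'w \<Rightarrow> 'x list set" where
  "paths \<omega>0 n \<omega> = {w \<in> lists X. length w = n \<and> act w \<omega>0 = \<omega>}"

lemma finite_words: "finite {w \<in> lists X. length w = n}"
  using finite_lists_length_eq[OF finite_X, of n] by (simp add: in_lists_conv_set subset_iff Collect_conj_eq lists_eq_set)

lemma finite_paths: "finite (paths \<omega>0 n \<omega>)"
  by (rule finite_subset[OF _ finite_words[of n]]) (auto simp: paths_def)

text \<open>Sort the words by their first letter, which acts last. Reindexing by the involution
  \<iota> turns preimages into images, so path counts evolve under exactly the operator that occurs
  in \<open>spectral_gap\<close>.\<close>

lemma card_paths_Suc:
  assumes "\<omega>0 \<in> \<Omega>" "\<omega> \<in> \<Omega>"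
  shows "card (paths \<omega>0 (Suc n) \<omega>) = (\<Sum>x\<in>X. card (paths \<omega>0 n (\<sigma> x \<omega>)))"
proof -
  have "paths \<omega>0 (Suc n) \<omega> = (\<Union>x\<in>X. (#) x ` paths \<omega>0 n (\<sigma> (\<iota> x) \<omega>))"
  proof (intro equalityI subsetI)
    fix w assume "w \<in> paths \<omega>0 (Suc n) \<omega>"
    then obtain x v where w: "w = x # v" "x \<in> X" "v \<in> lists X" "length v = n" "\<sigma> x (act v \<omega>0) = \<omega>"
      unfolding paths_def by (cases w) auto
    hence "act v \<omega>0 = \<sigma> (\<iota> x) \<omega>" using \<sigma>_\<iota>[OF w(2) act_in[OF w(3) assms(1)]] by simp
    thus "w \<in> (\<Union>x\<in>X. (#) x ` paths \<omega>0 n (\<sigma> (\<iota> x) \<omega>))" using w by (auto simp: paths_def)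
  next
    fix w assume "w \<in> (\<Union>x\<in>X. (#) x ` paths \<omega>0 n (\<sigma> (\<iota> x) \<omega>))"
    thus "w \<in> paths \<omega>0 (Suc n) \<omega>" using assms by (auto simp: paths_def \<sigma>_\<iota>')
  qed
  moreover have "card (\<Union>x\<in>X. (#) x ` paths \<omega>0 n (\<sigma> (\<iota> x) \<omega>))
      = (\<Sum>x\<in>X. card ((#) x ` paths \<omega>0 n (\<sigma> (\<iota> x) \<omega>)))"
    by (rule card_UN_disjoint) (auto simp: finite_X finite_paths)
  moreover have "(\<Sum>x\<in>X. card ((#) x ` paths \<omega>0 n (\<sigma> (\<iota> x) \<omega>))) = (\<Sum>x\<in>X. card (paths \<omega>0 n (\<sigma> (\<iota> x) \<omega>)))"
    by (intro sum.cong HOL.refl card_image) auto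
  moreover have "\<dots> = (\<Sum>x\<in>X. card (paths \<omega>0 n (\<sigma> x \<omega>)))"
    by (rule sum.reindex_bij_betw[OF \<iota>_bij])
  ultimately show ?thesis by simp
qed

text \<open>The counts arise from the indicator of \<omega>0 by applying the operator
  \<open>n\<close> times. Each application multiplies the squared norm by at most
  \<open>(1 - \<epsilon>) * d\<^sup>2\<close>, and a single value is bounded by the norm.\<close>

lemma paths_decay:
  assumes gap: "spectral_gap \<epsilon>" and \<epsilon>: "\<epsilon> \<le> 1" and \<omega>0: "\<omega>0 \<in> \<Omega>"
  shows "real (card (paths \<omega>0 n \<omega>0)) \<le> sqrt (1 - \<epsilon>) ^ n * d ^ n"
proof -
  \<comment> \<open>The reachable points form a finite set carrying the counts, as
    \<open>spectral_gap\<close> requires of its function.\<close>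
  define R where "R n = (\<lambda>w. act w \<omega>0) ` {w \<in> lists X. length w = n}" for n
  have R: "finite (R n)" "R n \<subseteq> \<Omega>" for n
    using finite_words act_in \<omega>0 by (auto simp: R_def)
  have outside: "card (paths \<omega>0 n \<omega>) = 0" if "\<omega> \<notin> R n" for n \<omega>
  proof -
    have "paths \<omega>0 n \<omega> = {}" using that by (auto simp: R_def paths_def)
    thus ?thesis by simp
  qed
  let ?N = "\<lambda>n. \<Sum>\<omega>\<in>R n. (real (card (paths \<omega>0 n \<omega>)))\<^sup>2"
  have "?N n \<le> ((1 - \<epsilon>) * d\<^sup>2) ^ n"
  proof (induction n)
    case 0
    have "R 0 = {\<omega>0}" "paths \<omega>0 0 \<omega>0 = {[]}" by (auto simp: R_def paths_def)
    thus ?case by simp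
  next
    case (Suc n)
    have "?N (Suc n) = (\<Sum>\<omega>\<in>R (Suc n). (\<Sum>x\<in>X. real (card (paths \<omega>0 n (\<sigma> x \<omega>))))\<^sup>2)"
      using R(2)[of "Suc n"] \<omega>0 by (intro sum.cong HOL.refl) (auto simp: card_paths_Suc subset_iff)
    also have "\<dots> \<le> (1 - \<epsilon>) * d\<^sup>2 * ?N n"
      by (intro gap[unfolded spectral_gap_def, rule_format] conjI R ballI) (simp add: outside)
    also have "\<dots> \<le> (1 - \<epsilon>) * d\<^sup>2 * ((1 - \<epsilon>) * d\<^sup>2) ^ n"
      using \<epsilon> Suc by (intro mult_left_mono) auto
    finally show ?case by simp
  qed
  moreover have "(real (card (paths \<omega>0 n \<omega>0)))\<^sup>2 \<le> ?N n"
  proof (cases "\<omega>0 \<in> R n")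
    case True
    thus ?thesis using member_le_sum[of \<omega>0 "R n" "\<lambda>\<omega>. (real (card (paths \<omega>0 n \<omega>)))\<^sup>2"] R by auto
  next
    case False
    thus ?thesis using outside[OF False] by (auto intro: sum_nonneg)
  qed
  ultimately have "(real (card (paths \<omega>0 n \<omega>0)))\<^sup>2 \<le> ((1 - \<epsilon>) * d\<^sup>2) ^ n" by simp
  also have "\<dots> = (sqrt (1 - \<epsilon>) ^ n * d ^ n)\<^sup>2"
  proof -
    have "(sqrt (1 - \<epsilon>) ^ n)\<^sup>2 = (1 - \<epsilon>) ^ n"
      using \<epsilon> by (metis power_mult mult.commute real_sqrt_pow2 diff_ge_0_iff_ge)
    moreover have "(d ^ n)\<^sup>2 = (d\<^sup>2) ^ n" by (metis power_mult mult.commute)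
    ultimately show ?thesis by (simp only: power_mult_distrib)
  qed
  finally show ?thesis
    by (rule power2_le_imp_le) (use \<epsilon> in simp)
qed

text \<open>Kesten's criterion in the direction from non-amenability to decay. Since
  \<open>d ^ n\<close> is the number of all words of length \<open>n\<close>, \<rho> bounds the
  growth rate of the return probabilities.\<close>

theorem Kesten:
  assumes "\<omega>0 \<in> \<Omega>" and "\<nexists>m. mean_on \<Omega> m \<and> (\<forall>x\<in>X. \<forall>A\<subseteq>\<Omega>. m (\<sigma> x ` A) = m A)"
  obtains \<rho> where "0 \<le> \<rho>" "\<rho> < 1"
    "\<And>n. real (card (paths \<omega>0 n \<omega>0)) \<le> \<rho> ^ n * d ^ n"
proof -
  obtain \<epsilon> where \<epsilon>: "0 < \<epsilon>" "spectral_gap \<epsilon>" using invariant_mean assms(2) by blast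
  \<comment> \<open>A gap may be shrunk, and \<open>paths_decay\<close> needs
    \<open>1 - \<epsilon>\<close> to be non-negative.\<close>
  have gap: "spectral_gap (min \<epsilon> 1)"
    unfolding spectral_gap_def
  proof (intro allI impI, elim conjE)
    fix f :: "'w \<Rightarrow> real" and S B
    assume *: "finite S" "S \<subseteq> \<Omega>" "\<forall>\<omega>\<in>\<Omega> - S. f \<omega> = 0" "finite B" "B \<subseteq> \<Omega>"
    have "(\<Sum>\<omega>\<in>B. (\<Sum>x\<in>X. f (\<sigma> x \<omega>))\<^sup>2) \<le> (1 - \<epsilon>) * d\<^sup>2 * (\<Sum>\<omega>\<in>S. (f \<omega>)\<^sup>2)"
      using \<epsilon>(2) * unfolding spectral_gap_def by blast
    also have "\<dots> \<le> (1 - min \<epsilon> 1) * d\<^sup>2 * (\<Sum>\<omega>\<in>S. (f \<omega>)\<^sup>2)"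
      by (intro mult_right_mono) (auto intro!: sum_nonneg)
    finally show "(\<Sum>\<omega>\<in>B. (\<Sum>x\<in>X. f (\<sigma> x \<omega>))\<^sup>2) \<le> (1 - min \<epsilon> 1) * d\<^sup>2 * (\<Sum>\<omega>\<in>S. (f \<omega>)\<^sup>2)" .
  qed
  show thesis
  proof (rule that[of "sqrt (1 - min \<epsilon> 1)"])
    show "real (card (paths \<omega>0 n \<omega>0)) \<le> sqrt (1 - min \<epsilon> 1) ^ n * d ^ n" for n
      using paths_decay[OF gap _ assms(1)] by simp
  qed (use \<epsilon> in auto)
qed

end

section \<open>Words in groups with a non-amenable quotient of a subgroup\<close>

lemma (in group) letter_value_closed:
  assumes "\<pi> ` A \<subseteq> carrier G" "l \<in> letters A"
  shows "letter_value G \<pi> l \<in> carrier G"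
  using assms by (auto simp: letters_def)

lemma (in group) word_value_closed:
  assumes "\<pi> ` A \<subseteq> carrier G" "w \<in> lists (letters A)"
  shows "word_value G \<pi> w \<in> carrier G"
  using assms(2) by (induction w) (auto simp: letter_value_closed[OF assms(1)])

lemma (in group) word_value_append:
  assumes "\<pi> ` A \<subseteq> carrier G" "v \<in> lists (letters A)" "w \<in> lists (letters A)"
  shows "word_value G \<pi> (v @ w) = word_value G \<pi> v \<otimes> word_value G \<pi> w"
  using assms(2)
  by (induction v)
     (auto simp: m_assoc letter_value_closed[OF assms(1)] word_value_closed[OF assms(1)] assms(3))

lemma inv_letter_in: "l \<in> letters A \<Longrightarrow> inv_letter l \<in> letters A"
  by (auto simp: letters_def)

lemma inv_letter_inv_letter [simp]: "inv_letter (inv_letter l) = l"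
  by (cases l) auto

lemma (in group) letter_value_inv_letter:
  assumes "\<pi> ` A \<subseteq> carrier G" "l \<in> letters A"
  shows "letter_value G \<pi> (inv_letter l) = inv (letter_value G \<pi> l)"
  using assms by (auto simp: letters_def)

lemma (in group) word_exists:
  assumes "finite_generating_set G A \<pi>" "g \<in> carrier G"
  obtains w where "w \<in> lists (letters A)" "word_value G \<pi> w = g"
proof -
  have A: "\<pi> ` A \<subseteq> carrier G" and g: "g \<in> generate G (\<pi> ` A)"
    using assms by (auto simp: finite_generating_set_def)
  from g have "\<exists>w\<in>lists (letters A). word_value G \<pi> w = g"
  proof induction
    case one
    show ?case by (intro bexI[of _ "[]"]) auto
  next
    case (incl h)
    then obtain a where "a \<in> A" "h = \<pi> a" by auto
    thus ?case using A by (intro bexI[of _ "[Pos a]"]) (auto simp: letters_def)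
  next
    case (inv h)
    then obtain a where "a \<in> A" "h = \<pi> a" by auto
    thus ?case using A by (intro bexI[of _ "[Neg a]"]) (auto simp: letters_def)
  next
    case (eng h1 h2)
    then obtain v w where "v \<in> lists (letters A)" "word_value G \<pi> v = h1"
      "w \<in> lists (letters A)" "word_value G \<pi> w = h2" by auto
    thus ?case using word_value_append[OF A, of v w] by (intro bexI[of _ "v @ w"]) auto
  qed
  thus thesis using that by auto
qed

lemma mean_on_null_Union:
  assumes mean: "mean_on \<Omega> m" and "finite T"
    and "\<And>t. t \<in> T \<Longrightarrow> A t \<subseteq> \<Omega>" "\<And>t. t \<in> T \<Longrightarrow> m (A t) = 0"
  shows "m (\<Union>t\<in>T. A t) = 0"
  using assms(2-)
proof (induction T)
  case empty
  have "m ({} \<union> {}) = m {} + m {}" using mean unfolding mean_on_def by blast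
  thus ?case by simp
next
  case (insert t T)
  let ?B = "\<Union>t\<in>T. A t"
  have B: "?B \<subseteq> \<Omega>" and t: "A t \<subseteq> \<Omega>" using insert by auto
  have add: "m (S \<union> T) = m S + m T" if "S \<subseteq> \<Omega>" "T \<subseteq> \<Omega>" "S \<inter> T = {}" for S T
    using mean that unfolding mean_on_def by blast
  have nonneg: "0 \<le> m S" if "S \<subseteq> \<Omega>" for S
    using mean that unfolding mean_on_def by blast
  have "m (?B \<union> (A t - ?B)) = m ?B + m (A t - ?B)"
    by (rule add) (use B t in auto)
  moreover have "m ((A t \<inter> ?B) \<union> (A t - ?B)) = m (A t \<inter> ?B) + m (A t - ?B)"
    by (rule add) (use t in auto)
  moreover have "(A t \<inter> ?B) \<union> (A t - ?B) = A t" "?B \<union> (A t - ?B) = (\<Union>t\<in>insert t T. A t)" by auto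
  moreover have "m (A t \<inter> ?B) \<ge> 0" "m (A t - ?B) \<ge> 0"
    by (rule nonneg; use t in auto)+
  ultimately show ?case using insert by auto
qed

text \<open>\<open>N\<close> need not be normal in \<open>G\<close>. The space acted on below is
  therefore just the set of left cosets of \<open>N\<close> in \<open>G\<close>, under left
  translation.\<close>

locale quotient_of_subgroup = group G for G (structure) +
  fixes H N
  assumes HG: "subgroup H G" and N: "N \<lhd> G\<lparr>carrier := H\<rparr>"
begin

abbreviation K where "K \<equiv> G\<lparr>carrier := H\<rparr> Mod N"

lemma NG: "subgroup N G"
  using incl_subgroup[OF HG normal_imp_subgroup[OF N]] .

lemma H_carrier: "h \<in> H \<Longrightarrow> h \<in> carrier G"
  using subgroup.subset[OF HG] by auto

lemma N_H: "n \<in> N \<Longrightarrow> n \<in> H"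
  using subgroup.subset[OF normal_imp_subgroup[OF N]] by auto

lemma N_subset: "N \<subseteq> carrier G"
  using subgroup.subset[OF NG] .

lemma group_K: "group K"
  using normal.factorgroup_is_group[OF N] .

text \<open>\<open>Mod\<close> is made of right cosets, whereas \<open>G\<close> acts on left
  cosets. Normality in \<open>H\<close> identifies the two for elements of \<open>H\<close>, which
  places the carrier of \<open>K\<close> inside the space acted on.\<close>

lemma coset_commute: "h \<in> H \<Longrightarrow> N #> h = h <# N"
  using normal.coset_eq[OF N] by (auto simp: r_coset_def l_coset_def)

lemma carrier_K: "carrier K = (\<lambda>h. N #> h) ` H"
  by (auto simp: carrier_FactGroup r_coset_def)

lemma mult_K: "h \<in> H \<Longrightarrow> h' \<in> H \<Longrightarrow> (N #> h) \<otimes>\<^bsub>K\<^esub> (N #> h') = N #> (h \<otimes> h')"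
  using normal.rcos_sum[OF N, of h h'] by (simp add: r_coset_def set_mult_def)

lemma l_coset_eq_self: "n \<in> N \<Longrightarrow> n <# N = N"
  using coset_commute[OF N_H] coset_join2[OF _ NG] N_subset by (metis subsetD)

lemma r_coset_eq_selfD: "h \<in> carrier G \<Longrightarrow> N #> h = N \<Longrightarrow> h \<in> N"
  using rcos_self[OF _ NG] by metis

lemma carrier_K': "carrier K = (\<lambda>h. h <# N) ` H"
  unfolding carrier_K using coset_commute by (intro image_cong) auto

lemma amenable_quotient:
  assumes index: "finite (rcosets H)" and gen: "finite_generating_set G A \<pi>"
  assumes mean: "mean_on ((\<lambda>g. g <# N) ` carrier G) m"
    and inv: "\<And>l S. l \<in> letters A \<Longrightarrow> S \<subseteq> (\<lambda>g. g <# N) ` carrier G \<Longrightarrow>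
       m ((\<lambda>\<omega>. letter_value G \<pi> l <# \<omega>) ` S) = m S"
  shows "amenable K"
proof -
  let ?\<Omega> = "(\<lambda>g. g <# N) ` carrier G"
  have \<pi>: "\<pi> ` A \<subseteq> carrier G" using gen by (simp add: finite_generating_set_def)
  have trans: "g <# (h <# N) = (g \<otimes> h) <# N" if "g \<in> carrier G" "h \<in> carrier G" for g h
    by (rule lcos_m_assoc[OF N_subset that])
  have trans_in: "(\<lambda>\<omega>. g <# \<omega>) ` S \<subseteq> ?\<Omega>" if "g \<in> carrier G" "S \<subseteq> ?\<Omega>" for g S
    using that trans by (auto simp: subset_iff)
  have inv_word: "\<forall>S. S \<subseteq> ?\<Omega> \<longrightarrow> m ((\<lambda>\<omega>. word_value G \<pi> w <# \<omega>) ` S) = m S" if "w \<in> lists (letters A)" for w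
    using that
  proof (induction w)
    case Nil
    have "(\<lambda>\<omega>. \<one> <# \<omega>) ` S = S" if "S \<subseteq> ?\<Omega>" for S
    proof -
      have "\<one> <# \<omega> = \<omega>" if "\<omega> \<in> S" for \<omega>
        using that \<open>S \<subseteq> ?\<Omega>\<close> trans[of \<one>] by auto
      thus ?thesis by simp
    qed
    thus ?case by simp
  next
    case (Cons l w)
    have l: "letter_value G \<pi> l \<in> carrier G" and w: "word_value G \<pi> w \<in> carrier G"
      using Cons letter_value_closed[OF \<pi>] word_value_closed[OF \<pi>] by auto
    show ?case
    proof (intro allI impI)
      fix S assume S: "S \<subseteq> ?\<Omega>"
      have "(letter_value G \<pi> l \<otimes> word_value G \<pi> w) <# \<omega> = letter_value G \<pi> l <# (word_value G \<pi> w <# \<omega>)"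
        if "\<omega> \<in> S" for \<omega>
      proof -
        have "\<omega> \<subseteq> carrier G" using that S N_subset l_coset_subset_G by blast
        thus ?thesis using lcos_m_assoc l w by simp
      qed
      hence "(\<lambda>\<omega>. word_value G \<pi> (l # w) <# \<omega>) ` S =
         (\<lambda>\<omega>. letter_value G \<pi> l <# \<omega>) ` (\<lambda>\<omega>. word_value G \<pi> w <# \<omega>) ` S"
        unfolding image_image by (intro image_cong) auto
      thus "m ((\<lambda>\<omega>. word_value G \<pi> (l # w) <# \<omega>) ` S) = m S"
        using inv[OF _ trans_in[OF w S]] Cons S by auto
    qed
  qed
  have inv_g: "m ((\<lambda>\<omega>. g <# \<omega>) ` S) = m S" if "g \<in> carrier G" "S \<subseteq> ?\<Omega>" for g S
    using word_exists[OF gen that(1)] inv_word that(2) by metis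
  have HN: "carrier K \<subseteq> ?\<Omega>" using H_carrier by (auto simp: carrier_K')
  obtain R where R: "finite R" "R \<subseteq> carrier G" "rcosets H = (\<lambda>r. H #> r) ` R"
  proof -
    have "rcosets H \<subseteq> (\<lambda>r. H #> r) ` carrier G" by (auto simp: RCOSETS_def)
    from finite_subset_image[OF index this] that show thesis by blast
  qed
  \<comment> \<open>Inversion turns right coset representatives of \<open>H\<close> into left ones:
    if \<open>inv g\<close> lies in \<open>H #> r\<close>, then \<open>g\<close> lies in
    \<open>inv r <# H\<close>.\<close>
  have cover: "?\<Omega> = (\<Union>r\<in>R. (\<lambda>\<omega>. inv r <# \<omega>) ` carrier K)"
  proof (intro equalityI subsetI)
    fix \<omega> assume "\<omega> \<in> ?\<Omega>"
    then obtain g where g: "g \<in> carrier G" "\<omega> = g <# N" by auto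
    have "H #> inv g \<in> rcosets H" using g by (auto simp: RCOSETS_def)
    then obtain r where r: "r \<in> R" "H #> inv g = H #> r" using R by auto
    have "inv g \<in> H #> r" using rcos_self[OF _ HG, of "inv g"] g r by auto
    then obtain h where h: "h \<in> H" "inv g = h \<otimes> r" by (auto simp: r_coset_def)
    have rc: "r \<in> carrier G" using r R by auto
    have "g = inv r \<otimes> inv h"
      using h rc g H_carrier[OF h(1)] by (metis inv_inv inv_mult_group)
    hence "\<omega> = inv r <# (inv h <# N)" using g rc H_carrier[OF h(1)] trans by simp
    moreover have "inv h <# N \<in> carrier K"
      using subgroup.m_inv_closed[OF HG h(1)] by (auto simp: carrier_K')
    ultimately show "\<omega> \<in> (\<Union>r\<in>R. (\<lambda>\<omega>. inv r <# \<omega>) ` carrier K)" using r by auto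
  next
    fix \<omega> assume "\<omega> \<in> (\<Union>r\<in>R. (\<lambda>\<omega>. inv r <# \<omega>) ` carrier K)"
    thus "\<omega> \<in> ?\<Omega>" using trans_in[OF _ HN] R by blast
  qed
  have pos: "m (carrier K) > 0"
  proof (rule ccontr)
    assume "\<not> m (carrier K) > 0"
    moreover have "m (carrier K) \<ge> 0" using mean HN unfolding mean_on_def by blast
    ultimately have "m (carrier K) = 0" by simp
    hence "m ((\<lambda>\<omega>. inv r <# \<omega>) ` carrier K) = 0" if "r \<in> R" for r
      using inv_g[OF _ HN] R that by auto
    hence "m ?\<Omega> = 0"
      unfolding cover by (intro mean_on_null_Union[OF mean] trans_in[OF _ HN]) (use R in auto)
    thus False using mean by (simp add: mean_on_def)
  qed
  \<comment> \<open>Multiplying cosets in \<open>K\<close> amounts to translating by a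
    representative, and under such translations \<open>m\<close> is known to be invariant.\<close>
  have l_coset_K: "g <#\<^bsub>K\<^esub> S = (\<lambda>\<omega>. h <# \<omega>) ` S" if h: "h \<in> H" "g = N #> h" and S: "S \<subseteq> carrier K" for g h S
  proof -
    have "g \<otimes>\<^bsub>K\<^esub> \<omega> = h <# \<omega>" if "\<omega> \<in> S" for \<omega>
    proof -
      obtain h' where h': "h' \<in> H" "\<omega> = N #> h'" using \<open>\<omega> \<in> S\<close> S unfolding carrier_K by blast
      have "g \<otimes>\<^bsub>K\<^esub> \<omega> = N #> (h \<otimes> h')" using mult_K h h' by simp
      also have "\<dots> = (h \<otimes> h') <# N" using coset_commute subgroup.m_closed[OF HG h(1) h'(1)] by simp
      also have "\<dots> = h <# \<omega>" using trans h h' H_carrier coset_commute by simp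
      finally show ?thesis .
    qed
    thus ?thesis by (auto simp: l_coset_def simp del: mult_FactGroup)
  qed
  show ?thesis
    unfolding amenable_def
  proof (intro exI[of _ "\<lambda>S. m S / m (carrier K)"] conjI allI impI ballI)
    fix S T assume "S \<subseteq> carrier K" "T \<subseteq> carrier K" "S \<inter> T = {}"
    hence "m (S \<union> T) = m S + m T" using mean HN unfolding mean_on_def by (meson order.trans)
    thus "m (S \<union> T) / m (carrier K) = m S / m (carrier K) + m T / m (carrier K)"
      by (simp add: add_divide_distrib)
  next
    fix g S assume g: "g \<in> carrier K" and S: "S \<subseteq> carrier K"
    obtain h where "h \<in> H" "g = N #> h" using g by (auto simp: carrier_K)
    hence "m (g <#\<^bsub>K\<^esub> S) = m S"
      using l_coset_K[OF _ _ S] inv_g[OF H_carrier] S HN by auto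
    thus "m (g <#\<^bsub>K\<^esub> S) / m (carrier K) = m S / m (carrier K)" by simp
  next
    fix S assume "S \<subseteq> carrier K"
    thus "0 \<le> m S / m (carrier K)" using mean HN pos unfolding mean_on_def
      by (intro divide_nonneg_pos) auto
  qed (use pos in auto)
qed

lemma word_decay:
  assumes index: "finite (rcosets H)" and gen: "finite_generating_set G A \<pi>"
    and "\<not> amenable K"
  obtains \<rho> where "0 \<le> \<rho>" "\<rho> < 1"
    "\<And>n. real (card {w \<in> lists (letters A). length w = n \<and> word_value G \<pi> w \<in> N})
       \<le> \<rho> ^ n * real (card (letters A)) ^ n"
proof (cases "letters A = {}")
  case True
  have sub: "{w \<in> lists (letters A). length w = n \<and> word_value G \<pi> w \<in> N} \<subseteq> (if n = 0 then {[]} else {})" for n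
    using True by auto
  show thesis
  \<comment> \<open>Over an empty alphabet there is only the empty word; the bound holds for it
    because \<open>0 ^ 0 = 1\<close>.\<close>
  proof (rule that[of 0])
    fix n :: nat
    have "card {w \<in> lists (letters A). length w = n \<and> word_value G \<pi> w \<in> N}
        \<le> card (if n = 0 then {[] :: 'c letter list} else {})"
      using sub[of n] by (rule card_mono[rotated]) simp
    also have "\<dots> = (if n = 0 then 1 else 0)" by simp
    finally show "real (card {w \<in> lists (letters A). length w = n \<and> word_value G \<pi> w \<in> N})
        \<le> 0 ^ n * real (card (letters A)) ^ n"
      by (cases "n = 0") simp_all
  qed simp_all
next
  case False
  let ?\<Omega> = "(\<lambda>g. g <# N) ` carrier G" and ?\<sigma> = "\<lambda>l \<omega>. letter_value G \<pi> l <# \<omega>"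
  have \<pi>: "\<pi> ` A \<subseteq> carrier G" and A: "finite A" using gen by (auto simp: finite_generating_set_def)
  note lv = letter_value_closed[OF \<pi>] letter_value_inv_letter[OF \<pi>]
  have trans: "g <# (h <# N) = (g \<otimes> h) <# N" if "g \<in> carrier G" "h \<in> carrier G" for g h
    by (rule lcos_m_assoc[OF N_subset that])
  have assoc: "inv g \<otimes> (g \<otimes> h) = h" if "g \<in> carrier G" "h \<in> carrier G" for g h
    using that by (simp add: m_assoc[symmetric])
  interpret symmetric_action ?\<Omega> "letters A" ?\<sigma> inv_letter
  proof unfold_locales
    show "finite (letters A)" using A by (simp add: letters_def)
    fix x \<omega> assume x: "x \<in> letters A" and "\<omega> \<in> ?\<Omega>"
    then obtain g where g: "g \<in> carrier G" "\<omega> = g <# N" by auto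
    show "?\<sigma> x \<omega> \<in> ?\<Omega>" using g x by (simp add: trans lv)
    show "?\<sigma> (inv_letter x) (?\<sigma> x \<omega>) = \<omega>" using g x by (simp add: trans lv assoc)
  qed (use False inv_letter_in in auto)
  have base: "N \<in> ?\<Omega>" using lcos_mult_one[OF N_subset] by (metis image_eqI one_closed)
  have "\<nexists>m. mean_on ?\<Omega> m \<and> (\<forall>x\<in>letters A. \<forall>S\<subseteq>?\<Omega>. m (?\<sigma> x ` S) = m S)"
    using amenable_quotient[OF index gen] assms(3) by blast
  then obtain \<rho> where \<rho>: "0 \<le> \<rho>" "\<rho> < 1"
      "\<And>n. real (card (paths N n N)) \<le> \<rho> ^ n * real (card (letters A)) ^ n"
    using Kesten[OF base] by blast
  \<comment> \<open>\<open>act\<close> lets the last letter act first, which agrees with left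
    multiplication by the value of the word.\<close>
  have act: "act w N = word_value G \<pi> w <# N" if "w \<in> lists (letters A)" for w
    using that by (induction w)
      (auto simp: lcos_mult_one[OF N_subset] trans lv word_value_closed[OF \<pi>])
  have "card {w \<in> lists (letters A). length w = n \<and> word_value G \<pi> w \<in> N} \<le> card (paths N n N)" for n
  proof (intro card_mono finite_paths subsetI)
    fix w assume "w \<in> {w \<in> lists (letters A). length w = n \<and> word_value G \<pi> w \<in> N}"
    hence w: "w \<in> lists (letters A)" "length w = n" "word_value G \<pi> w \<in> N" by auto
    show "w \<in> paths N n N"
      unfolding paths_def using w act[OF w(1)] l_coset_eq_self[OF w(3)] by simp
  qed
  hence "real (card {w \<in> lists (letters A). length w = n \<and> word_value G \<pi> w \<in> N})
       \<le> \<rho> ^ n * real (card (letters A)) ^ n" for n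
    using \<rho>(3)[of n] by (meson of_nat_mono order.trans)
  thus thesis using that \<rho> by blast
qed

text \<open>
  Reidemeister--Schreier rewriting: the state \<open>c\<close> stands for the coset of the transversal
  element \<open>t c\<close>, and reading a letter contributes its Schreier element in \<open>H\<close>.
\<close>

lemma coset_automaton:
  assumes index: "finite (rcosets H)"
  obtains Q :: "nat set" and q0 t nxt where
    "finite Q" "q0 \<in> Q" "t q0 = \<one>" "\<And>c. c \<in> Q \<Longrightarrow> t c \<in> carrier G"
    "\<And>c. c \<in> Q \<Longrightarrow> t c \<in> H \<Longrightarrow> c = q0"
    "\<And>c g. c \<in> Q \<Longrightarrow> g \<in> carrier G \<Longrightarrow> nxt c g \<in> Q \<and> t c \<otimes> g \<otimes> inv (t (nxt c g)) \<in> H"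
proof -
  obtain e :: "nat \<Rightarrow> 'a set" and k where e: "bij_betw e {..<k} (rcosets H)"
    using ex_bij_betw_nat_finite[OF index] by (auto simp: atLeast0LessThan)
  have "H \<in> rcosets H" using subgroup.rcosets_non_empty coset_join2[OF one_closed HG]
    subgroup.one_closed[OF HG] by (auto simp: RCOSETS_def)
  then obtain q0 where q0: "q0 < k" "e q0 = H"
    unfolding bij_betw_imp_surj_on[OF e, symmetric] by auto
  have "\<exists>g. g \<in> carrier G \<and> e c = H #> g" if "c < k" for c
  proof -
    have "e c \<in> rcosets H" using that e by (auto simp: bij_betw_def)
    thus ?thesis by (auto simp: RCOSETS_def)
  qed
  then obtain t0 where t0: "\<And>c. c < k \<Longrightarrow> t0 c \<in> carrier G \<and> e c = H #> t0 c" by metis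
  \<comment> \<open>With \<open>\<one>\<close> as representative of \<open>H\<close>, the Schreier
    elements along a word that leads from \<open>q0\<close> back to \<open>q0\<close> multiply to
    the value of the word, without conjugation.\<close>
  define t where "t c = (if c = q0 then \<one> else t0 c)" for c
  have t: "t c \<in> carrier G" "e c = H #> t c" if "c < k" for c
    using that t0 q0 coset_join2[OF one_closed HG] subgroup.one_closed[OF HG] by (auto simp: t_def)
  have "\<exists>c'. c' < k \<and> e c' = H #> (t c \<otimes> g)" if "c < k" "g \<in> carrier G" for c g
  proof -
    have "H #> (t c \<otimes> g) \<in> rcosets H" using t(1) that by (auto simp: RCOSETS_def)
    then obtain c' where "c' < k" "e c' = H #> (t c \<otimes> g)"
      unfolding bij_betw_imp_surj_on[OF e, symmetric] by auto
    thus ?thesis by blast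
  qed
  then obtain nxt where nxt: "\<And>c g. c < k \<Longrightarrow> g \<in> carrier G \<Longrightarrow> nxt c g < k \<and> e (nxt c g) = H #> (t c \<otimes> g)"
    by metis
  show thesis
  proof (rule that[of "{..<k}" q0 t nxt])
    show "c = q0" if "c \<in> {..<k}" "t c \<in> H" for c
    proof -
      have "e c = e q0" using that t q0 coset_join2[OF _ HG, of "t c"] by auto
      thus ?thesis using e that q0 by (auto simp: bij_betw_def inj_on_def)
    qed
    show "nxt c g \<in> {..<k} \<and> t c \<otimes> g \<otimes> inv (t (nxt c g)) \<in> H" if "c \<in> {..<k}" "g \<in> carrier G" for c g
    proof -
      have c: "c < k" using that by simp
      have n: "nxt c g < k" "H #> t (nxt c g) = H #> (t c \<otimes> g)" using nxt[OF c that(2)] t(2) by auto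
      have cl: "t c \<otimes> g \<in> carrier G" "t (nxt c g) \<in> carrier G" using t(1) c n that by auto
      have "t c \<otimes> g \<in> H #> t (nxt c g)" using rcos_self[OF cl(1) HG] n by simp
      then obtain h where "h \<in> H" "t c \<otimes> g = h \<otimes> t (nxt c g)" by (auto simp: r_coset_def)
      thus ?thesis using n cl H_carrier by (simp add: m_assoc)
    qed
  qed (use q0 t in \<open>auto simp: t_def\<close>)
qed

end

section \<open>Average running time\<close>

text \<open>A length-invariant measure only distributes weights over the lengths, so its expectation
  is a weighted combination of uniform averages. A bound on these averages therefore holds with the
  same constant for all such measures.\<close>

lemma average_time_bounded_length_invariant:
  fixes f :: "nat \<Rightarrow> real"
  assumes X: "finite X" and M: "tm_decides M X L" and f: "mono f" "\<And>n. 0 < f n" and C: "C > 0"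
    and total: "\<And>n. (\<Sum>w | w \<in> lists X \<and> length w = n. real (tm_time M w)) \<le> C * f n * real (card X) ^ n"
  shows "average_time_bounded M X L f (length_invariant_measures X)"
proof -
  define W where "W n = {w \<in> lists X. length w = n}" for n
  have W_eq: "W n = {w. set w \<subseteq> X \<and> length w = n}" for n by (auto simp: W_def)
  have W: "finite (W n)" "card (W n) = card X ^ n" for n
    unfolding W_eq by (simp_all add: finite_lists_length_eq[OF X] card_lists_length_eq[OF X])
  have "(\<lambda>w. real (tm_time M w) / f (length w) * \<mu> w) summable_on lists X \<and>
        (\<Sum>\<^sub>\<infinity>w\<in>lists X. real (tm_time M w) / f (length w) * \<mu> w) \<le> C"
    if \<mu>: "\<mu> \<in> length_invariant_measures X" for \<mu>
  proof -
    let ?g = "\<lambda>w. real (tm_time M w) / f (length w) * \<mu> w"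
    have nonneg: "0 \<le> \<mu> w" if "w \<in> lists X" for w
    proof -
      have "\<mu> w \<in> {0..1}"
        using \<mu>[unfolded length_invariant_measures_def, THEN CollectD, THEN conjunct1] that
        unfolding discrete_prob_measure_def by blast
      thus ?thesis by simp
    qed
    have sum1: "(\<mu> has_sum 1) (lists X)"
      using \<mu> by (simp add: length_invariant_measures_def discrete_prob_measure_def)
    have inv: "\<mu> w = \<mu> w'" if "w \<in> lists X" "w' \<in> lists X" "length w = length w'" for w w'
      by (rule \<mu>[unfolded length_invariant_measures_def, THEN CollectD, THEN conjunct2, rule_format, OF that])
    have g0: "0 \<le> ?g w" if "w \<in> lists X" for w
      using nonneg[OF that] f(2)[of "length w"] by (intro mult_nonneg_nonneg divide_nonneg_pos) auto
    have level: "(\<Sum>w\<in>W n. ?g w) \<le> C * (\<Sum>w\<in>W n. \<mu> w)" for n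
    proof (cases "W n = {}")
      case False
      then obtain v where v: "v \<in> W n" by auto
      have eq: "\<mu> w = \<mu> v" if "w \<in> W n" for w using that v inv by (auto simp: W_def)
      have "(\<Sum>w\<in>W n. ?g w) = (\<Sum>w\<in>W n. real (tm_time M w) * (\<mu> v / f n))"
        by (rule sum.cong) (simp_all add: eq, simp add: W_def)
      also have "\<dots> = (\<Sum>w\<in>W n. real (tm_time M w)) * (\<mu> v / f n)"
        by (rule sum_distrib_right[symmetric])
      also have "\<dots> \<le> (C * f n * real (card X) ^ n) * (\<mu> v / f n)"
        using total[of n] nonneg[of v] v f(2)[of n]
        by (intro mult_right_mono divide_nonneg_pos) (auto simp: W_def)
      also have "\<dots> = C * (real (card X) ^ n * \<mu> v)" using f(2)[of n] by simp
      also have "real (card X) ^ n * \<mu> v = (\<Sum>w\<in>W n. \<mu> w)"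
        using eq W by simp
      finally show ?thesis .
    qed simp
    have fin: "sum ?g S \<le> C" if S: "finite S" "S \<subseteq> lists X" for S
    proof -
      obtain b where b: "\<forall>w\<in>S. length w \<le> b"
        using finite_nat_set_iff_bounded_le[of "length ` S"] S by auto
      \<comment> \<open>The estimate \<open>level\<close> needs complete sets of words of one
        length. All terms being non-negative, \<open>S\<close> may be enlarged to a union of such
        sets.\<close>
      let ?U = "\<Union>n\<in>{..b}. W n"
      have U: "finite ?U" "?U \<subseteq> lists X" "S \<subseteq> ?U" using W S b by (auto simp: W_def)
      have disj: "\<forall>i\<in>{..b}. \<forall>j\<in>{..b}. i \<noteq> j \<longrightarrow> W i \<inter> W j = {}" by (auto simp: W_def)
      have "sum ?g S \<le> sum ?g ?U"
      proof (rule sum_mono2[OF U(1,3)])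
        fix w assume "w \<in> ?U - S"
        hence "w \<in> lists X" using U(2) by blast
        thus "0 \<le> ?g w" by (rule g0)
      qed
      also have "\<dots> = (\<Sum>n\<le>b. \<Sum>w\<in>W n. ?g w)" using W disj by (intro sum.UNION_disjoint) auto
      also have "\<dots> \<le> (\<Sum>n\<le>b. C * (\<Sum>w\<in>W n. \<mu> w))" by (intro sum_mono level)
      also have "\<dots> = C * (\<Sum>n\<le>b. \<Sum>w\<in>W n. \<mu> w)" by (simp add: sum_distrib_left)
      also have "(\<Sum>n\<le>b. \<Sum>w\<in>W n. \<mu> w) = sum \<mu> ?U" using W disj by (intro sum.UNION_disjoint[symmetric]) auto
      also have "C * sum \<mu> ?U \<le> C * 1"
        using C has_sum_mono2[OF has_sum_finite[OF U(1)] sum1 U(2)] nonneg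
        by (intro mult_left_mono) auto
      finally show ?thesis by simp
    qed
    have s: "?g summable_on lists X"
    proof (rule nonneg_bdd_above_summable_on[OF g0])
      show "bdd_above (sum ?g ` {S. S \<subseteq> lists X \<and> finite S})"
        by (rule bdd_aboveI2[of _ _ C]) (use fin in blast)
    qed
    show ?thesis using s infsum_le_finite_sums[OF s fin] by blast
  qed
  thus ?thesis using M f C unfolding average_time_bounded_def by blast
qed

lemma subexponential_bound:
  assumes "subexponential f" "r > 1"
  obtains K where "K > 0" "\<And>n. f n \<le> K * r ^ n"
proof -
  have "Bseq (\<lambda>n. f n / r ^ n)"
    using assms convergentI convergent_imp_Bseq unfolding subexponential_def by blast
  then obtain K where "K > 0" "\<And>n. norm (f n / r ^ n) \<le> K" by (auto simp: Bseq_def)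
  hence "f n \<le> K * r ^ n" for n
    using \<open>r > 1\<close> by (metis abs_le_D1 divide_le_eq real_norm_def zero_less_power less_trans zero_less_one)
  thus thesis using that \<open>K > 0\<close> by blast
qed

section \<open>Proof of the theorem\<close>

context quotient_of_subgroup
begin

text \<open>An instance of \<open>composite\<close>: machine \<open>False\<close> performs the test
  in \<open>K\<close> on the Schreier rewriting \<open>u1 w\<close>, machine \<open>True\<close>
  decides the translation \<open>u0 w\<close> in \<open>G\<close>. The time bound refers to
  membership in \<open>N\<close> instead of passing the test, because that is what
  \<open>word_decay\<close> counts.\<close>

lemma filtering_machine:
  fixes A0 A1 :: "'c::countable set" and \<pi>0 :: "'c \<Rightarrow> 'a" and \<pi>1 :: "'c \<Rightarrow> 'a set"
  assumes index: "finite (rcosets H)"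
    and A: "finite_generating_set G A \<pi>"
    and A0: "finite_generating_set G A0 \<pi>0" and M0: "tm_decides M0 (letters A0) (WP G A0 \<pi>0)"
    and A1: "finite_generating_set K A1 \<pi>1" and M1: "tm_decides M1 (letters A1) (WP K A1 \<pi>1)"
  obtains M and B :: nat and u0 u1 where "B \<ge> 1" "tm_decides M (letters A) (WP G A \<pi>)"
    "\<And>w. w \<in> lists (letters A) \<Longrightarrow> u0 w \<in> lists (letters A0) \<and> length (u0 w) \<le> B * length w \<and>
       u1 w \<in> lists (letters A1) \<and> length (u1 w) \<le> B * length w"
    "\<And>w. w \<in> lists (letters A) \<Longrightarrow> tm_time M w \<le> (4 * B + 1) * length w + 4 + tm_time M1 (u1 w)
       + (if word_value G \<pi> w \<in> N then tm_time M0 (u0 w) else 0)"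
proof -
  have \<pi>: "\<pi> ` A \<subseteq> carrier G" "\<pi>0 ` A0 \<subseteq> carrier G" "\<pi>1 ` A1 \<subseteq> carrier K" and finA: "finite (letters A)"
    using A A0 A1 by (auto simp: finite_generating_set_def letters_def)
  obtain Q :: "nat set" and q0 t nx where Q: "finite Q" "q0 \<in> Q" "t q0 = \<one>"
    and t: "\<And>c. c \<in> Q \<Longrightarrow> t c \<in> carrier G"
    and tH: "\<And>c. c \<in> Q \<Longrightarrow> t c \<in> H \<Longrightarrow> c = q0"
    and nx: "\<And>c g. c \<in> Q \<Longrightarrow> g \<in> carrier G \<Longrightarrow> nx c g \<in> Q \<and> t c \<otimes> g \<otimes> inv (t (nx c g)) \<in> H"
  proof (rule coset_automaton[OF index], goal_cases)
    case (1 Q q0 t nx)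
    show thesis by (rule 1(1)[OF 1(2-7)])
  qed
  have "\<exists>v. v \<in> lists (letters A0) \<and> word_value G \<pi>0 v = g" if "g \<in> carrier G" for g
    by (rule word_exists[OF A0 that]) (intro exI conjI)
  hence "\<forall>g. \<exists>v. g \<in> carrier G \<longrightarrow> v \<in> lists (letters A0) \<and> word_value G \<pi>0 v = g" by simp
  from choice[OF this] obtain v0
    where v0: "\<And>g. g \<in> carrier G \<Longrightarrow> v0 g \<in> lists (letters A0) \<and> word_value G \<pi>0 (v0 g) = g" by auto
  have "\<exists>v. v \<in> lists (letters A1) \<and> word_value K \<pi>1 v = N #> h" if "h \<in> H" for h
  proof -
    have "N #> h \<in> carrier K" unfolding carrier_K using that by (rule imageI)
    thus ?thesis by (rule group.word_exists[OF group_K A1]) (intro exI conjI)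
  qed
  hence "\<forall>h. \<exists>v. h \<in> H \<longrightarrow> v \<in> lists (letters A1) \<and> word_value K \<pi>1 v = N #> h" by simp
  from choice[OF this] obtain v1
    where v1: "\<And>h. h \<in> H \<Longrightarrow> v1 h \<in> lists (letters A1) \<and> word_value K \<pi>1 (v1 h) = N #> h" by auto
  define val where "val = letter_value G \<pi>"
  have val: "x \<in> letters A \<Longrightarrow> val x \<in> carrier G" for x
    unfolding val_def by (rule letter_value_closed[OF \<pi>(1)])
  define nxt where "nxt c x = nx c (val x)" for c x
  define ou where "ou b c x = (if b then v0 (val x) else v1 (t c \<otimes> val x \<otimes> inv (t (nxt c x))))" for b c x
  define Y where "Y b = (if b then letters A0 else letters A1)" for b
  define M where "M b = (if b then M0 else M1)" for b
  define L where "L b = (if b then WP G A0 \<pi>0 else WP K A1 \<pi>1)" for b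
  have nxt_in: "nxt c x \<in> Q" "t c \<otimes> val x \<otimes> inv (t (nxt c x)) \<in> H" if "c \<in> Q" "x \<in> letters A" for c x
    using nx[OF that(1) val[OF that(2)]] by (auto simp: nxt_def)
  have "finite ((\<lambda>(b, c, x). length (ou b c x)) ` (UNIV \<times> Q \<times> letters A))"
    using Q finA by simp
  then obtain B0 where B0: "\<forall>n\<in>(\<lambda>(b, c, x). length (ou b c x)) ` (UNIV \<times> Q \<times> letters A). n \<le> B0"
    using finite_nat_set_iff_bounded_le by blast
  \<comment> \<open>The successor ensures \<open>B \<ge> 1\<close>, since a \<open>B\<close>-th root
    will be taken.\<close>
  define B where "B = Suc B0"
  have dec_M: "tm_decides (M b) (Y b) (L b)" for b
    using M0 M1 by (simp add: M_def Y_def L_def)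
  interpret composite "letters A" Y M Q q0 nxt ou "{q0}" B
  proof
    show "wf_tm (Y b) (M b)" for b using dec_M[of b] by (simp add: tm_decides_def)
    show "ou b c x \<in> lists (Y b)" if "c \<in> Q" "x \<in> letters A" for b c x
      using v0[OF val[OF that(2)]] v1[OF nxt_in(2)[OF that]] by (simp add: ou_def Y_def)
    show "length (ou b c x) \<le> B" if "c \<in> Q" "x \<in> letters A" for b c x
      using B0 that unfolding B_def by (intro le_SucI) auto
  qed (use finA Q nxt_in in auto)
  have cancel: "inv a \<otimes> (a \<otimes> b) = b" if "a \<in> carrier G" "b \<in> carrier G" for a b
    using that by (simp add: m_assoc[symmetric])
  \<comment> \<open>The induction needs an arbitrary initial state \<open>c\<close>. Consecutive
    Schreier elements telescope: \<open>inv (t c')\<close> at the end of one meets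
    \<open>t c'\<close> at the beginning of the next.\<close>
  have coset_values: "t c \<otimes> word_value G \<pi> w \<otimes> inv (t (drive c w)) \<in> H \<and>
      word_value K \<pi>1 (emit False c w) = N #> (t c \<otimes> word_value G \<pi> w \<otimes> inv (t (drive c w))) \<and>
      word_value G \<pi>0 (emit True c w) = word_value G \<pi> w"
    if "c \<in> Q" "w \<in> lists (letters A)" for c w
    using that
  proof (induction w arbitrary: c)
    case Nil
    have "t c \<otimes> \<one> \<otimes> inv (t (drive c [])) = \<one>" using t[OF Nil(1)] by simp
    moreover have "N #> \<one> = N" using coset_mult_one[OF N_subset] .
    ultimately show ?case using subgroup.one_closed[OF HG] by simp
  next
    case (Cons x w)
    let ?c = "nxt c x" and ?s = "t c \<otimes> val x \<otimes> inv (t (nxt c x))"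
    let ?s' = "t ?c \<otimes> word_value G \<pi> w \<otimes> inv (t (drive ?c w))"
    have x: "x \<in> letters A" and w: "w \<in> lists (letters A)" using Cons.prems by auto
    note n = nxt_in[OF Cons.prems(1) x]
    note IH = Cons.IH[OF n(1) w, THEN conjunct1] Cons.IH[OF n(1) w, THEN conjunct2, THEN conjunct1]
      Cons.IH[OF n(1) w, THEN conjunct2, THEN conjunct2]
    have ou_value: "word_value K \<pi>1 (ou False c x) = N #> ?s" "word_value G \<pi>0 (ou True c x) = val x"
      using v0[OF val[OF x]] v1[OF n(2)] by (simp_all add: ou_def)
    have wv: "word_value G \<pi> w \<in> carrier G" by (rule word_value_closed[OF \<pi>(1) w])
    have tc: "t (drive ?c w) \<in> carrier G" "t ?c \<in> carrier G" "t c \<in> carrier G"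
      using t drive_in[OF n(1) w] n(1) Cons.prems(1) by auto
    have s: "?s \<otimes> ?s' = t c \<otimes> (val x \<otimes> word_value G \<pi> w) \<otimes> inv (t (drive ?c w))"
      using tc wv val[OF x] by (simp add: m_assoc cancel)
    have e: "ou b c x \<in> lists (Y b)" "emit b ?c w \<in> lists (Y b)" for b
      using out[OF Cons.prems(1) x] emit_in[OF n(1) w] by auto
    have "word_value K \<pi>1 (emit False c (x # w))
        = word_value K \<pi>1 (ou False c x) \<otimes>\<^bsub>K\<^esub> word_value K \<pi>1 (emit False ?c w)"
      using group.word_value_append[OF group_K \<pi>(3)] e[of False] by (simp add: Y_def del: mult_FactGroup)
    also have "\<dots> = (N #> ?s) \<otimes>\<^bsub>K\<^esub> (N #> ?s')"
      by (simp only: ou_value IH)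
    also have "\<dots> = N #> (?s \<otimes> ?s')" by (rule mult_K[OF n(2) IH(1)])
    finally have 1: "word_value K \<pi>1 (emit False c (x # w)) = N #> (?s \<otimes> ?s')" .
    have 2: "word_value G \<pi>0 (emit True c (x # w)) = val x \<otimes> word_value G \<pi> w"
      using word_value_append[OF \<pi>(2)] e[of True] by (simp add: Y_def ou_value IH(3))
    have 3: "?s \<otimes> ?s' \<in> H" by (rule subgroup.m_closed[OF HG n(2) IH(1)])
    show ?case using 1 2 3 unfolding s by (simp add: val_def)
  qed
  let ?passes = "\<lambda>w. drive q0 w \<in> {q0} \<and> emit False q0 w \<in> L False"
  \<comment> \<open>A return to \<open>q0\<close> means that the rewritten element is the value of
    the word itself; the test then says that its coset of \<open>N\<close> is trivial.\<close>
  have passes_N: "word_value G \<pi> w \<in> N" if "w \<in> lists (letters A)" "?passes w" for w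
  proof -
    have wv: "word_value G \<pi> w \<in> carrier G" by (rule word_value_closed[OF \<pi>(1) that(1)])
    have "N #> word_value G \<pi> w = N"
      using coset_values[OF Q(2) that(1)] that(2) Q(3) wv by (auto simp: L_def WP_def)
    thus ?thesis by (rule r_coset_eq_selfD[OF wv])
  qed
  \<comment> \<open>The test loses no solution: a word with value \<open>\<one>\<close> leads back
    to the coset \<open>H\<close>, hence to \<open>q0\<close>, and has trivial image in
    \<open>K\<close>. False positives are removed by the second machine.\<close>
  have lang: "?passes w \<and> emit True q0 w \<in> L True \<longleftrightarrow> w \<in> WP G A \<pi>" if w: "w \<in> lists (letters A)" for w
  proof
    assume "?passes w \<and> emit True q0 w \<in> L True"
    thus "w \<in> WP G A \<pi>" using coset_values[OF Q(2) w] w by (auto simp: L_def WP_def)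
  next
    assume "w \<in> WP G A \<pi>"
    hence 1: "word_value G \<pi> w = \<one>" by (simp add: WP_def)
    have tc: "t (drive q0 w) \<in> carrier G" using t drive_in[OF Q(2) w] by auto
    note v = coset_values[OF Q(2) w, unfolded 1 Q(3)]
    have "inv (t (drive q0 w)) \<in> H" using v tc by simp
    hence "t (drive q0 w) \<in> H" using subgroup.m_inv_closed[OF HG] tc by (metis inv_inv)
    hence d: "drive q0 w = q0" using tH drive_in[OF Q(2) w] by blast
    have "word_value K \<pi>1 (emit False q0 w) = N"
      using v coset_mult_one[OF N_subset] by (simp add: d Q(3))
    thus "?passes w \<and> emit True q0 w \<in> L True"
      using v d emit_in[OF Q(2) w, of False] emit_in[OF Q(2) w, of True]
      by (auto simp: L_def WP_def Y_def)
  qed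
  have run: "\<exists>n. fst (tm_run machine w n) = (if w \<in> WP G A \<pi> then Yes else No) \<and>
     n \<le> (4 * B + 1) * length w + 4 + tm_time M1 (emit False q0 w)
          + (if word_value G \<pi> w \<in> N then tm_time M0 (emit True q0 w) else 0)"
    if w: "w \<in> lists (letters A)" for w
  proof -
    obtain n where n:
      "fst (tm_run machine w n) = (if ?passes w \<and> emit True q0 w \<in> L True then Yes else No)"
      "n \<le> (4 * B + 1) * length w + 4 + tm_time (M False) (emit False q0 w)
          + (if ?passes w then tm_time (M True) (emit True q0 w) else 0)"
      using machine_time[OF dec_M w] .
    have "(if ?passes w then tm_time (M True) (emit True q0 w) else 0)
        \<le> (if word_value G \<pi> w \<in> N then tm_time M0 (emit True q0 w) else 0)"
      using passes_N[OF w] by (auto simp: M_def)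
    thus ?thesis using n unfolding lang[OF w] by (intro exI[of _ n]) (simp add: M_def)
  qed
  show thesis
  proof (rule that[of B machine "emit True q0" "emit False q0"])
    show "tm_decides machine (letters A) (WP G A \<pi>)"
      unfolding tm_decides_def using wf_machine run by blast
    show "tm_time machine w \<le> (4 * B + 1) * length w + 4 + tm_time M1 (emit False q0 w)
       + (if word_value G \<pi> w \<in> N then tm_time M0 (emit True q0 w) else 0)"
      if w: "w \<in> lists (letters A)" for w
    proof -
      obtain n where n: "fst (tm_run machine w n) = (if w \<in> WP G A \<pi> then Yes else No)"
        "n \<le> (4 * B + 1) * length w + 4 + tm_time M1 (emit False q0 w)
          + (if word_value G \<pi> w \<in> N then tm_time M0 (emit True q0 w) else 0)"
        using run[OF w] by blast
      have "tm_time machine w \<le> n" by (rule tm_time_le) (simp add: n halting_def)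
      thus ?thesis using n(2) by (rule order.trans)
    qed
    show "emit True q0 w \<in> lists (letters A0) \<and> length (emit True q0 w) \<le> B * length w \<and>
       emit False q0 w \<in> lists (letters A1) \<and> length (emit False q0 w) \<le> B * length w"
      if w: "w \<in> lists (letters A)" for w
      using emit_in[OF Q(2) w, of True] emit_in[OF Q(2) w, of False] emit_length[OF Q(2) w]
      by (simp add: Y_def)
  qed (simp add: B_def)
qed

end

theorem theoremA:
  fixes F :: "(nat \<Rightarrow> nat) set"
    and G :: "('g, 'b) monoid_scheme"
    and H :: "'g set"
    and N :: "'g set"
    and A :: "'x set"
    and \<pi> :: "'x \<Rightarrow> 'g"
  assumes "time_bounds F"
    and "time_class F \<subseteq> (SubExp :: nat language set)"
    and "group G"
    and "finitely_presented G"
    and "word_problem_in G SubExp"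
    and "subgroup H G"
    and "finite (rcosets\<^bsub>G\<^esub> H)"
    and "N \<lhd> G\<lparr>carrier := H\<rparr>"
    and "\<not> amenable (G\<lparr>carrier := H\<rparr> Mod N)"
    and "word_problem_in (G\<lparr>carrier := H\<rparr> Mod N) (time_class F)"
    and "finite_generating_set G A \<pi>"
  shows "average_case_solvable (letters A) (WP G A \<pi>) F (length_invariant_measures (letters A))"
proof -
  interpret quotient_of_subgroup G H N
    using assms by (simp add: quotient_of_subgroup_def quotient_of_subgroup_axioms_def)
  obtain A0 :: "nat set" and \<pi>0 f0 M0 where A0: "finite_generating_set G A0 \<pi>0"
    and f0: "subexponential f0" and M0: "tm_decides M0 (letters A0) (WP G A0 \<pi>0)"
    and T0: "\<And>w. w \<in> lists (letters A0) \<Longrightarrow> real (tm_time M0 w) \<le> f0 (length w)"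
    using assms(5) unfolding word_problem_in_def SubExp_def DTIME_def by auto
  obtain A1 :: "nat set" and \<pi>1 f M1 where A1: "finite_generating_set K A1 \<pi>1"
    and f: "f \<in> F" and M1: "tm_decides M1 (letters A1) (WP K A1 \<pi>1)"
    and T1: "\<And>w. w \<in> lists (letters A1) \<Longrightarrow> real (tm_time M1 w) \<le> real (f (length w))"
    using assms(10) unfolding word_problem_in_def time_class_def DTIME_def by auto
  obtain M B u0 u1 where B: "B \<ge> 1" and M: "tm_decides M (letters A) (WP G A \<pi>)"
    and u: "\<And>w. w \<in> lists (letters A) \<Longrightarrow> u0 w \<in> lists (letters A0) \<and> length (u0 w) \<le> B * length w \<and>
       u1 w \<in> lists (letters A1) \<and> length (u1 w) \<le> B * length w"
    and T: "\<And>w. w \<in> lists (letters A) \<Longrightarrow> tm_time M w \<le> (4 * B + 1) * length w + 4 + tm_time M1 (u1 w)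
       + (if word_value G \<pi> w \<in> N then tm_time M0 (u0 w) else 0)"
  proof (rule filtering_machine[OF assms(7,11) A0 M0 A1 M1], goal_cases)
    case (1 M B u0 u1)
    show thesis by (rule 1(1)[OF 1(2-5)])
  qed
  obtain \<rho>' where \<rho>': "0 \<le> \<rho>'" "\<rho>' < 1"
    and decay': "\<And>n. real (card {w \<in> lists (letters A). length w = n \<and> word_value G \<pi> w \<in> N})
       \<le> \<rho>' ^ n * real (card (letters A)) ^ n"
  proof (rule word_decay[OF assms(7,11,9)], goal_cases)
    case (1 \<rho>)
    show thesis by (rule 1(1)[OF 1(2-4)])
  qed
  \<comment> \<open>The decay rate may be 0; raising it to at least \<open>1 / 2\<close> keeps
    \<open>1 / \<rho>\<close> meaningful.\<close>
  define \<rho> where "\<rho> = max \<rho>' (1 / 2)"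
  have \<rho>: "0 < \<rho>" "\<rho> < 1" using \<rho>' by (auto simp: \<rho>_def)
  have decay: "real (card {w \<in> lists (letters A). length w = n \<and> word_value G \<pi> w \<in> N})
       \<le> \<rho> ^ n * real (card (letters A)) ^ n" for n
  proof -
    have "\<rho>' ^ n * real (card (letters A)) ^ n \<le> \<rho> ^ n * real (card (letters A)) ^ n"
      using \<rho>' by (intro mult_right_mono power_mono) (auto simp: \<rho>_def)
    thus ?thesis using decay'[of n] by linarith
  qed
  \<comment> \<open>The second machine gets inputs of length up to \<open>B * n\<close>, and this
    base makes \<open>r ^ (B * n)\<close> equal to \<open>(1 / \<rho>) ^ n\<close>.\<close>
  define r where "r = root B (1 / \<rho>)"
  have r: "r > 1" "r ^ B = 1 / \<rho>" using \<rho> B by (auto simp: r_def)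
  obtain k where k: "k > 0" "\<And>n. f0 n \<le> k * r ^ n" using subexponential_bound[OF f0 r(1)] by blast
  \<comment> \<open>One constant for several purposes: \<open>B * n\<close> and
    \<open>(4 * B + 1) * n\<close> are at most \<open>C * n + C\<close>, so that by
    \<open>n \<le> f n\<close> and monotonicity both the test and the linear overhead cost at most
    \<open>f (C * n + C)\<close>; and \<open>C\<close> exceeds the 2 and the 4 that remain.\<close>
  define C where "C = 4 * B + 5"
  define f' where "f' n = C * f (C * n + C) + C" for n
  have f'F: "f' \<in> F" using assms(1) f unfolding time_bounds_def f'_def C_def by simp
  have "mono f" and f_ge: "n \<le> f n" for n
    using assms(1) f by (auto simp: time_bounds_def proper_complexity_function_def)
  have "mono f'" unfolding f'_def
    by (intro monoI add_mono mult_le_mono2 monoD[OF \<open>mono f\<close>]) auto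
  have finX: "finite (letters A)" using assms(11) by (auto simp: finite_generating_set_def letters_def)
  have total: "(\<Sum>w | w \<in> lists (letters A) \<and> length w = n. real (tm_time M w))
      \<le> (1 + k) * real (f' n) * real (card (letters A)) ^ n" for n
  proof -
    let ?W = "{w \<in> lists (letters A). length w = n}"
    let ?Z = "{w \<in> lists (letters A). length w = n \<and> word_value G \<pi> w \<in> N}"
    let ?d = "real (card (letters A)) ^ n"
    have W_eq: "?W = {w. set w \<subseteq> letters A \<and> length w = n}" by auto
    have W: "finite ?W" "real (card ?W) = ?d"
      unfolding W_eq by (simp_all add: finite_lists_length_eq[OF finX] card_lists_length_eq[OF finX])
    have "real (tm_time M w) \<le> real (f' n) + (if word_value G \<pi> w \<in> N then k * (1 / \<rho>) ^ n else 0)"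
      if w: "w \<in> ?W" for w
    proof -
      from w have wl: "w \<in> lists (letters A)" "length w = n" by auto
      have "real (tm_time M1 (u1 w)) \<le> real (f (length (u1 w)))" using T1 u wl by blast
      also have "\<dots> \<le> real (f (C * n + C))"
        using u[OF wl(1)] wl(2) monoD[OF \<open>mono f\<close>, of "length (u1 w)" "C * n + C"]
        by (simp add: C_def algebra_simps)
      finally have 1: "tm_time M1 (u1 w) \<le> f (C * n + C)" by simp
      have "(4 * B + 1) * n \<le> f (C * n + C)"
        using f_ge[of "C * n + C"] by (simp add: C_def algebra_simps)
      hence "(4 * B + 1) * n + 4 + tm_time M1 (u1 w) \<le> 2 * f (C * n + C) + 4"
        using 1 by linarith
      also have "\<dots> \<le> f' n" unfolding f'_def by (intro add_mono mult_le_mono1) (auto simp: C_def)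
      finally have 2: "real ((4 * B + 1) * n + 4 + tm_time M1 (u1 w)) \<le> real (f' n)"
        by (rule of_nat_mono)
      have "real (tm_time M0 (u0 w)) \<le> f0 (length (u0 w))" using T0 u wl by blast
      also have "\<dots> \<le> k * r ^ length (u0 w)" by (rule k(2))
      also have "\<dots> \<le> k * r ^ (B * n)"
        using k r u[OF wl(1)] wl(2) by (intro mult_left_mono power_increasing) auto
      also have "\<dots> = k * (1 / \<rho>) ^ n" by (simp add: power_mult r(2))
      finally have 3: "real (tm_time M0 (u0 w)) \<le> k * (1 / \<rho>) ^ n" .
      have "real (tm_time M w) \<le> real ((4 * B + 1) * n + 4 + tm_time M1 (u1 w)
          + (if word_value G \<pi> w \<in> N then tm_time M0 (u0 w) else 0))"
        using T[OF wl(1)] wl(2) by (intro of_nat_mono) simp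
      thus ?thesis using 2 3 by (auto split: if_splits)
    qed
    hence "(\<Sum>w\<in>?W. real (tm_time M w))
        \<le> (\<Sum>w\<in>?W. real (f' n) + (if word_value G \<pi> w \<in> N then k * (1 / \<rho>) ^ n else 0))"
      by (rule sum_mono)
    also have "\<dots> = ?d * real (f' n) + (\<Sum>w\<in>?W. if word_value G \<pi> w \<in> N then k * (1 / \<rho>) ^ n else 0)"
      using W by (simp add: sum.distrib)
    also have "(\<Sum>w\<in>?W. if word_value G \<pi> w \<in> N then k * (1 / \<rho>) ^ n else 0)
        = (\<Sum>w\<in>?Z. k * (1 / \<rho>) ^ n)"
      using W by (subst sum.inter_filter[symmetric]) (auto intro: sum.cong)
    also have "\<dots> = real (card ?Z) * (k * (1 / \<rho>) ^ n)" by simp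
    \<comment> \<open>The decisive cancellation: the rarity \<open>\<rho> ^ n\<close> of the words
      in \<open>N\<close> against the cost \<open>(1 / \<rho>) ^ n\<close> of deciding each of
      them.\<close>
    also have "\<dots> \<le> (\<rho> ^ n * ?d) * (k * (1 / \<rho>) ^ n)"
      using decay[of n] k \<rho> by (intro mult_right_mono) auto
    also have "\<dots> = ?d * k" using \<rho> by (simp add: power_divide)
    also have "?d * k \<le> ?d * (k * real (f' n))"
    proof -
      have "1 \<le> real (f' n)" by (simp add: f'_def C_def)
      thus ?thesis using k by (intro mult_left_mono) auto
    qed
    finally show ?thesis by (simp add: algebra_simps)
  qed
  have "average_time_bounded M (letters A) (WP G A \<pi>) (\<lambda>n. real (f' n)) (length_invariant_measures (letters A))"
  proof (rule average_time_bounded_length_invariant[OF finX M _ _ _ total])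
    show "mono (\<lambda>n. real (f' n))" using \<open>mono f'\<close> by (simp add: mono_def)
    have "0 < f' n" for n by (simp add: f'_def C_def)
    thus "0 < real (f' n)" for n by simp
  qed (use k(1) in simp)
  thus ?thesis unfolding average_case_solvable_def using f'F by blast
qed

end
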